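(* Suppose that for every tournament forest $H$ there exists a family of tournaments that is both sparse and $H$-useful. Then for every square $0/1$ matrix $M$ which is a forest, $\mathrm{ex}(n,M)=n(\log n)^{O(1)}$, i.e., there are constants $C,p>0$ depending only on $M$ such that $\mathrm{ex}(n,M)\le Cn(\log n)^p$ for all sufficiently large $n$.
   Context: A tournament is a digraph having exactly one of the edges $(u,v),(v,u)$ for every pair of distinct vertices $u,v$. A set of vertices of a tournament is transitive if the sub-tournament it induces has no directed cycle. A tournament $H$ is a tournament forest if its vertex set can be partitioned into two transitive sets $L,R$ such that the undirected bipartite graph on $L$ and $R$ in which $\ell\in L$ is adjacent to $r\in R$ if and only if $H$ has the edge $(r,\ell)$ (pointing from $r$ to $\ell$) is a forest. A semi-complete digraph is a digraph in which every pair of distinct vertices is joined by at least one of the two possible edges; a pair $\{u,v\}$ is bidirectional if both $(u,v)$ and $(v,u)$ are edges. A digraph is $H$-free if it has no (not necessarily induced) subgraph isomorphic to $H$. Expanders: an undirected graph $U=(V,E)$ with at least two vertices is a $d$-expander if for every $S\subseteq V$ with $1\le |S|\le |V|/2$ there are at least $d|S|$ edges between $S$ and $V\setminus S$. A semi-complete digraph is a $d$-expander if the undirected graph on the same vertex set formed by its bidirectional pairs is a $d$-expander. For a semi-complete digraph $F$, ${\cal D}_F$ is the distribution over tournaments obtained from $F$ by choosing independently and uniformly, for each bidirectional pair $\{i,j\}$ of $F$, either the edge $(i,j)$ or the edge $(j,i)$ to be kept (all other edges of $F$ are kept). Sparse: a family of tournaments ${\cal Q}$ is sparse if there is a constant $b>0$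 such that for every $n$-vertex semi-complete digraph $F$ which is a $b\log^b n$-expander, $\mathbb{P}_{G\sim{\cal D}_F}[G\in{\cal Q}]<1/2$. Here $\log^b n=(\log n)^b$ and $\log$ is to base $2$. A homogeneous set of a tournament $G=(V,E)$ is a set $X\subseteq V$ such that for every $v\in V\setminus X$, either $(v,x)\in E$ for all $x\in X$ or $(x,v)\in E$ for all $x\in X$. A tournament is prime if it has no homogeneous set $X$ with $1<|X|<|V|$. A family of tournaments ${\cal Q}$ is $H$-useful if every prime tournament which is $H$-free belongs to ${\cal Q}$. A $k\times k$ $0/1$ matrix $M$ is a forest if the bipartite graph whose two sides are the set of rows and the set of columns of $M$, with row $i$ adjacent to column $j$ if and only if $M_{i,j}=1$, is a forest. An $n\times n$ $0/1$ matrix $A$ contains the pattern $M$ if $A$ has $k$ rows $r_1<\cdots<r_k$ and $k$ columns $c_1<\cdots<c_k$ such that $A_{r_i,c_j}=1$ whenever $M_{i,j}=1$. $\mathrm{ex}(n,M)$ (for $n\ge k$) is the least integer $m$ such that every $n\times n$ $0/1$ matrix with (at least) $m$ entries equal to $1$ contains the pattern $M$. *)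

theory Defs
  imports
    "Graph_Theory.Digraph_Isomorphism"
    "Graph_Theory.Pair_Digraph"
    "Jordan_Normal_Form.Matrix"
    "HOL-Probability.Product_PMF"
begin

text \<open>
  Digraphs are finite, without loops and parallel arcs (locale \<open>pair_digraph\<close>). Undirected simple
  graphs are represented by symmetric digraphs (locale \<open>pair_graph\<close>): an edge $uv$ is the pair of
  arcs $(u,v)$, $(v,u)$.
\<close>

text \<open>
  The constant \<open>forest\<close> of the library forbids every directed cycle, including the 2-cycle
  $u, v, u$ along the two arcs of one undirected edge, so it holds for no symmetric digraph with
  an arc. Cycles of an undirected graph have length at least 3.
\<close>

definition undirected_forest :: "'a pair_pre_digraph \<Rightarrow> bool" where
  "undirected_forest U \<longleftrightarrow>
     pair_graph U \<and> \<not> (\<exists>p. pre_digraph.cycle (with_proj U) p \<and> 3 \<le> length p)"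

definition bipartite_graph :: "'a set \<Rightarrow> 'a set \<Rightarrow> ('a \<Rightarrow> 'a \<Rightarrow> bool) \<Rightarrow> 'a pair_pre_digraph" where
  "bipartite_graph L R adj =
     (let E = {(l, r). l \<in> L \<and> r \<in> R \<and> adj l r}
      in \<lparr> pverts = L \<union> R, parcs = E \<union> E\<inverse> \<rparr>)"


section \<open>Tournaments\<close>

definition tournament :: "'a pair_pre_digraph \<Rightarrow> bool" where
  "tournament G \<longleftrightarrow> pair_digraph G \<and>
     (\<forall>u\<in>pverts G. \<forall>v\<in>pverts G. u \<noteq> v \<longrightarrow> ((u, v) \<in> parcs G \<longleftrightarrow> (v, u) \<notin> parcs G))"

definition transitive_set :: "'a pair_pre_digraph \<Rightarrow> 'a set \<Rightarrow> bool" where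
  "transitive_set G S \<longleftrightarrow>
     S \<subseteq> pverts G \<and> \<not> (\<exists>p. pre_digraph.cycle (with_proj G \<restriction> S) p)"

definition tournament_forest :: "'a pair_pre_digraph \<Rightarrow> bool" where
  "tournament_forest H \<longleftrightarrow> tournament H \<and>
     (\<exists>L R. L \<union> R = pverts H \<and> L \<inter> R = {} \<and> transitive_set H L \<and> transitive_set H R \<and>
        undirected_forest (bipartite_graph L R (\<lambda>l r. (r, l) \<in> parcs H)))"

definition free_of :: "'b pair_pre_digraph \<Rightarrow> 'a pair_pre_digraph \<Rightarrow> bool" where
  "free_of H G \<longleftrightarrow>
     \<not> (\<exists>K :: 'a pair_pre_digraph. subgraph (with_proj K) (with_proj G)
                                  \<and> digraph_iso (with_proj K) (with_proj H))"

definition homogeneous_set :: "'a pair_pre_digraph \<Rightarrow> 'a set \<Rightarrow> bool" where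
  "homogeneous_set G X \<longleftrightarrow> X \<subseteq> pverts G \<and>
     (\<forall>v\<in>pverts G - X. (\<forall>x\<in>X. (v, x) \<in> parcs G) \<or> (\<forall>x\<in>X. (x, v) \<in> parcs G))"

definition prime_tournament :: "'a pair_pre_digraph \<Rightarrow> bool" where
  "prime_tournament G \<longleftrightarrow> tournament G \<and>
     \<not> (\<exists>X. homogeneous_set G X \<and> 1 < card X \<and> card X < card (pverts G))"

definition useful :: "'b pair_pre_digraph \<Rightarrow> 'a pair_pre_digraph set \<Rightarrow> bool" where
  "useful H Q \<longleftrightarrow> (\<forall>G. prime_tournament G \<and> free_of H G \<longrightarrow> G \<in> Q)"


section \<open>Semi-complete digraphs and expanders\<close>

definition semi_complete :: "'a pair_pre_digraph \<Rightarrow> bool" where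
  "semi_complete F \<longleftrightarrow> pair_digraph F \<and>
     (\<forall>u\<in>pverts F. \<forall>v\<in>pverts F. u \<noteq> v \<longrightarrow> (u, v) \<in> parcs F \<or> (v, u) \<in> parcs F)"

text \<open>
  In the symmetric digraph \<open>U\<close>, each undirected edge between $S$ and its complement contributes
  exactly one arc leaving $S$.
\<close>

definition expander :: "real \<Rightarrow> 'a pair_pre_digraph \<Rightarrow> bool" where
  "expander d U \<longleftrightarrow> pair_graph U \<and> 2 \<le> card (pverts U) \<and>
     (\<forall>S\<subseteq>pverts U. 1 \<le> card S \<and> real (card S) \<le> real (card (pverts U)) / 2 \<longrightarrow>
        d * real (card S) \<le> real (card (parcs U \<inter> S \<times> (pverts U - S))))"

definition bidirectional_graph :: "'a pair_pre_digraph \<Rightarrow> 'a pair_pre_digraph" where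
  "bidirectional_graph F = \<lparr> pverts = pverts F, parcs = parcs F \<inter> (parcs F)\<inverse> \<rparr>"

definition semi_complete_expander :: "real \<Rightarrow> 'a pair_pre_digraph \<Rightarrow> bool" where
  "semi_complete_expander d F \<longleftrightarrow> semi_complete F \<and> expander d (bidirectional_graph F)"

definition bidirectional_pairs :: "'a pair_pre_digraph \<Rightarrow> 'a set set" where
  "bidirectional_pairs F = {{u, v} | u v. (u, v) \<in> parcs F \<and> (v, u) \<in> parcs F}"

text \<open>
  A choice \<open>c\<close> maps each bidirectional pair $\{i,j\}$ to the arc that is kept, which is uniform on
  $\{(i,j),(j,i)\}$; \<open>Pi_pmf\<close> makes the choices independent.
\<close>

definition random_tournament :: "'a pair_pre_digraph \<Rightarrow> 'a pair_pre_digraph pmf" where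
  "random_tournament F =
     map_pmf (\<lambda>c. \<lparr> pverts = pverts F,
                     parcs = {(u, v). (u, v) \<in> parcs F \<and> (v, u) \<notin> parcs F}
                             \<union> c ` bidirectional_pairs F \<rparr>)
       (Pi_pmf (bidirectional_pairs F) undefined (\<lambda>e. pmf_of_set {(u, v). {u, v} = e}))"

definition sparse_family :: "'a pair_pre_digraph set \<Rightarrow> bool" where
  "sparse_family Q \<longleftrightarrow> (\<exists>b>0. \<forall>F.
     semi_complete_expander (b * log 2 (real (card (pverts F))) powr b) F \<longrightarrow>
     measure_pmf.prob (random_tournament F) Q < 1 / 2)"


section \<open>Forbidden patterns in 0/1 matrices\<close>

definition zero_one_mat :: "nat \<Rightarrow> nat mat \<Rightarrow> bool" where
  "zero_one_mat n A \<longleftrightarrow> A \<in> carrier_mat n n \<and> elements_mat A \<subseteq> {0, 1}"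

definition num_ones :: "nat mat \<Rightarrow> nat" where
  "num_ones A = card {(i, j). i < dim_row A \<and> j < dim_col A \<and> A $$ (i, j) = 1}"

definition forest_mat :: "nat mat \<Rightarrow> bool" where
  "forest_mat M \<longleftrightarrow> undirected_forest
     (bipartite_graph (Inl ` {..<dim_row M}) (Inr ` {..<dim_col M})
       (\<lambda>x y. \<exists>i j. x = Inl i \<and> y = Inr j \<and> M $$ (i, j) = 1))"

definition contains_pattern :: "nat mat \<Rightarrow> nat mat \<Rightarrow> bool" where
  "contains_pattern A M \<longleftrightarrow>
     (\<exists>r c. strict_mono_on {..<dim_row M} r \<and> r ` {..<dim_row M} \<subseteq> {..<dim_row A} \<and>
            strict_mono_on {..<dim_col M} c \<and> c ` {..<dim_col M} \<subseteq> {..<dim_col A} \<and>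
            (\<forall>i<dim_row M. \<forall>j<dim_col M. M $$ (i, j) = 1 \<longrightarrow> A $$ (r i, c j) = 1))"

text \<open>The minimum exists, since no \<open>n \<times> n\<close> matrix has more than \<open>n\<^sup>2\<close> ones.\<close>

definition ex_mat :: "nat \<Rightarrow> nat mat \<Rightarrow> nat" where
  "ex_mat n M = (LEAST m. \<forall>A. zero_one_mat n A \<and> m \<le> num_ones A \<longrightarrow> contains_pattern A M)"

end

theory Submission
  imports Defs
begin

text \<open>
  Think of an \<open>n \<times> n\<close> matrix \<open>A\<close> as an ordered bipartite graph:
  the rows, followed by the columns, are the vertices, and the ones are the edges. Orient all
  pairs of vertices upwards and make the ones bidirectional. In a tournament obtained by resolving
  the bidirectional pairs, every downward arc is an entry 1 of \<open>A\<close>. If such a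
  tournament contains a suitable tournament forest \<open>H\<close> built from \<open>M\<close>,
  then the pattern \<open>M\<close> can be read off from the downward arcs of the copy of
  \<open>H\<close>.

  Such a copy comes from the hypothesis. If \<open>A\<close> has more than about
  \<open>d n log n\<close> ones, then repeated removal of sparse cuts leads to an induced subgraph
  that is a \<open>d\<close>-expander (\<open>card_edges_le_if_no_expander\<close>). For a
  suitable polylogarithmic \<open>d\<close>, a random orientation of it is prime with probability
  at least 1/2 (\<open>prob_not_prime_le\<close>), as a homogeneous set would force the direction
  of too many independent choices, and it lies outside the sparse family \<open>Q\<close> with
  probability more than 1/2. So some orientation is both, and since \<open>Q\<close> is
  \<open>H\<close>-useful, it contains \<open>H\<close>.

  The remaining difficulty is that a copy of \<open>H\<close> need not respect the partition into
  rows and columns. For this reason \<open>H\<close> consists of many copies of \<open>M\<close>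
  along the diagonal, in each of which every row and column has a private neighbour. If no copy of
  \<open>M\<close> is placed correctly, then many rows, or many columns, are misplaced, and cyclic
  triangles with the private neighbours force these to be misplaced as well. Misplaced rows and
  misplaced columns together span a large submatrix of ones, which contains every pattern
  (\<open>has_pattern_if_embeds\<close>). The private neighbours keep \<open>H\<close> a
  tournament forest (\<open>tournament_forest_block_copies\<close>).
\<close>


section \<open>Expanders in dense graphs\<close>

lemma expander_antimono:
  assumes "expander d U" "d' \<le> d"
  shows "expander d' U"
  using assms unfolding expander_def
  by (meson mult_right_mono of_nat_0_le_iff order_trans)

lemma pair_graph_induced:
  assumes "finite W" "sym E" "irrefl E"
  shows "pair_graph \<lparr>pverts = W, parcs = E \<inter> W \<times> W\<rparr>"
proof -
  have "sym (E \<inter> W \<times> W)"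
    using assms(2) by (auto simp: sym_def)
  then show ?thesis
    using assms by unfold_locales (auto simp: symmetric_def irrefl_def)
qed

text \<open>
  If no subset of \<open>W\<close> induces an expander, then \<open>W\<close> has a sparse cut,
  and so do both sides of that cut, down to single vertices. Each cut is charged to its smaller
  side, \<open>d\<close> edges per vertex. A vertex is on the smaller side at most
  \<open>log 2 (card W)\<close> times, because its part then at least halves. The factor 2 in the
  bound comes from an undirected edge being two arcs.
\<close>

lemma card_edges_le_if_no_expander:
  fixes E :: "('a \<times> 'a) set"
  assumes "sym E" "irrefl E" "0 \<le> d" "finite W" "W \<noteq> {}"
    and "\<And>W'. W' \<subseteq> W \<Longrightarrow> \<not> expander d \<lparr>pverts = W', parcs = E \<inter> W' \<times> W'\<rparr>"
  shows "real (card (E \<inter> W \<times> W)) \<le> 2 * d * real (card W) * log 2 (real (card W))"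
  using assms(4-)
proof (induction "card W" arbitrary: W rule: less_induct)
  case less
  show ?case
  proof (cases "card W = 1")
    case True
    then obtain w where "W = {w}"
      by (auto simp: card_1_singleton_iff)
    then have "E \<inter> W \<times> W = {}"
      using \<open>irrefl E\<close> by (auto simp: irrefl_def)
    then show ?thesis
      using True by simp
  next
    case False
    then have W2: "2 \<le> card W"
      using less.prems by (metis One_nat_def Suc_1 Suc_leI card_gt_0_iff le_neq_implies_less)
    have "pair_graph \<lparr>pverts = W, parcs = E \<inter> W \<times> W\<rparr>"
      using assms less.prems by (intro pair_graph_induced) auto
    with less.prems(3)[of W] W2 obtain S where S: "S \<subseteq> W" "1 \<le> card S"
        "real (card S) \<le> real (card W) / 2"
        "real (card (E \<inter> W \<times> W \<inter> S \<times> (W - S))) < d * real (card S)"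
      unfolding expander_def by (simp add: not_le) blast
    define T where "T = W - S"
    have fin: "finite S" "finite T" "finite W"
      using less.prems S(1) finite_subset unfolding T_def by auto
    have card_W: "card W = card S + card T"
      using S(1) fin by (simp add: T_def card_Diff_subset card_mono)
    have T_sub: "T \<subseteq> W"
      by (auto simp: T_def)
    have T_pos: "1 \<le> card T" and T_less: "card T < card W" and S_less: "card S < card W"
      using S(2,3) card_W by linarith+
    have bound: "real (card (E \<inter> Z \<times> Z)) \<le> 2 * d * real (card Z) * log 2 (real (card Z))"
      if "Z \<subseteq> W" "1 \<le> card Z" "card Z < card W" for Z
      using that less.prems fin by (intro less.hyps) (auto intro: finite_subset)
    have cut: "card (E \<inter> T \<times> S) = card (E \<inter> S \<times> T)"
    proof -
      have "E \<inter> T \<times> S = (E \<inter> S \<times> T)\<inverse>"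
        using \<open>sym E\<close> by (auto simp: sym_def)
      then show ?thesis
        by simp
    qed
    have "E \<inter> W \<times> W \<inter> S \<times> (W - S) = E \<inter> S \<times> T"
      using S(1) by (auto simp: T_def)
    then have cut_less: "real (card (E \<inter> S \<times> T)) < d * real (card S)"
      using S(4) by simp
    have W_split: "E \<inter> W \<times> W = (E \<inter> S \<times> S \<union> E \<inter> T \<times> T) \<union> (E \<inter> S \<times> T \<union> E \<inter> T \<times> S)"
      using S(1) by (auto simp: T_def)
    have "card (E \<inter> W \<times> W)
        \<le> (card (E \<inter> S \<times> S) + card (E \<inter> T \<times> T)) + (card (E \<inter> S \<times> T) + card (E \<inter> T \<times> S))"
      by (subst W_split) (rule order_trans[OF card_Un_le add_mono[OF card_Un_le card_Un_le]])
    then have "real (card (E \<inter> W \<times> W))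
        \<le> real (card (E \<inter> S \<times> S)) + real (card (E \<inter> T \<times> T)) + 2 * real (card (E \<inter> S \<times> T))"
      using cut by linarith
    also have "\<dots> \<le> 2 * d * real (card S) * log 2 (real (card S))
        + 2 * d * real (card T) * log 2 (real (card T)) + 2 * (d * real (card S))"
      using bound[OF S(1,2) S_less] bound[OF T_sub T_pos T_less] cut_less by linarith
    \<comment> \<open>The charge for the cut is absorbed by doubling the argument of the logarithm for the smaller side.\<close>
    also have "\<dots> = 2 * d * (real (card S) * log 2 (2 * real (card S))
        + real (card T) * log 2 (real (card T)))"
      using S(2) by (simp add: log_mult algebra_simps)
    also have "\<dots> \<le> 2 * d * (real (card S) * log 2 (real (card W))
        + real (card T) * log 2 (real (card W)))"
      using S T_pos T_less \<open>0 \<le> d\<close> by (intro mult_left_mono add_mono) auto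
    also have "\<dots> = 2 * d * real (card W) * log 2 (real (card W))"
      by (simp add: card_W algebra_simps)
    finally show ?thesis .
  qed
qed


section \<open>Random orientations of expanders are prime\<close>

definition orientations :: "'a set \<Rightarrow> ('a \<times> 'a) set" where
  "orientations e = {(u, v). {u, v} = e}"

definition resolve :: "'a pair_pre_digraph \<Rightarrow> ('a set \<Rightarrow> 'a \<times> 'a) \<Rightarrow> 'a pair_pre_digraph" where
  "resolve F c = \<lparr> pverts = pverts F,
     parcs = {(u, v). (u, v) \<in> parcs F \<and> (v, u) \<notin> parcs F} \<union> c ` bidirectional_pairs F \<rparr>"

lemma pverts_resolve [simp]: "pverts (resolve F c) = pverts F"
  by (simp add: resolve_def)

definition choices :: "'a pair_pre_digraph \<Rightarrow> ('a set \<Rightarrow> 'a \<times> 'a) set" where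
  "choices F = PiE_dflt (bidirectional_pairs F) undefined (\<lambda>e. orientations e)"

lemma orientations_of_pair:
  assumes "e \<in> bidirectional_pairs F" "pair_digraph F"
  shows "card (orientations e) = 2" "finite (orientations e)" "orientations e \<noteq> {}"
proof -
  obtain a b where e: "e = {a, b}" "(a, b) \<in> parcs F"
    using assms(1) by (auto simp: bidirectional_pairs_def)
  have "a \<noteq> b"
    using e(2) pair_loopfree_digraph.no_loops' assms(2) unfolding pair_digraph_def by metis
  moreover have "orientations e = {(a, b), (b, a)}"
    by (auto simp: e orientations_def doubleton_eq_iff)
  ultimately show "card (orientations e) = 2" "finite (orientations e)"
    "orientations e \<noteq> {}"
    by auto
qed

lemma finite_bidirectional_pairs:
  assumes "pair_digraph F"
  shows "finite (bidirectional_pairs F)"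
proof -
  have "finite (parcs F)"
    using assms by (simp add: pair_digraph_def pair_fin_digraph_def pair_fin_digraph_axioms_def)
  moreover have "bidirectional_pairs F \<subseteq> (\<lambda>(u, v). {u, v}) ` parcs F"
    by (auto simp: bidirectional_pairs_def)
  ultimately show ?thesis
    using finite_surj by blast
qed

lemma random_tournament_eq:
  assumes "pair_digraph F"
  shows "random_tournament F = map_pmf (resolve F) (pmf_of_set (choices F))"
proof -
  have "Pi_pmf (bidirectional_pairs F) undefined (\<lambda>e. pmf_of_set (orientations e))
      = pmf_of_set (choices F)"
    unfolding choices_def
    using finite_bidirectional_pairs[OF assms] orientations_of_pair[OF _ assms]
    by (intro Pi_pmf_of_set) auto
  then show ?thesis
    by (simp add: random_tournament_def resolve_def[abs_def] orientations_def)
qed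

lemma choices_finite_card:
  assumes "pair_digraph F"
  shows "finite (choices F)" "choices F \<noteq> {}" "card (choices F) = 2 ^ card (bidirectional_pairs F)"
proof -
  note fin = finite_bidirectional_pairs[OF assms]
  show "finite (choices F)"
    unfolding choices_def using fin orientations_of_pair(2)[OF _ assms] by (rule finite_PiE_dflt)
  have "card (choices F) = (\<Prod>e\<in>bidirectional_pairs F. card (orientations e))"
    unfolding choices_def using fin orientations_of_pair(2)[OF _ assms] by (rule card_PiE_dflt)
  also have "\<dots> = (\<Prod>e\<in>bidirectional_pairs F. 2)"
    using orientations_of_pair[OF _ assms] by (intro prod.cong) auto
  finally show "card (choices F) = 2 ^ card (bidirectional_pairs F)"
    by simp
  then show "choices F \<noteq> {}"
    by auto
qed

lemma prob_random_tournament: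
  assumes "pair_digraph F"
  shows "measure_pmf.prob (random_tournament F) Q
    = real (card {c \<in> choices F. resolve F c \<in> Q}) / 2 ^ card (bidirectional_pairs F)"
proof -
  have "choices F \<inter> resolve F -` Q = {c \<in> choices F. resolve F c \<in> Q}"
    by auto
  then show ?thesis
    using choices_finite_card[OF assms]
    by (simp add: random_tournament_eq[OF assms] measure_pmf_of_set)
qed

lemma arc_resolve_iff:
  assumes "c \<in> choices F"
  shows "(u, v) \<in> parcs (resolve F c) \<longleftrightarrow>
    (u, v) \<in> parcs F \<and> ((v, u) \<in> parcs F \<longrightarrow> c {u, v} = (u, v))"
proof -
  have c: "{fst (c e), snd (c e)} = e" if "e \<in> bidirectional_pairs F" for e
  proof -
    have "c e \<in> orientations e"
      using assms that by (simp add: choices_def PiE_dflt_def)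
    then show ?thesis
      by (auto simp: orientations_def)
  qed
  have "(u, v) \<in> c ` bidirectional_pairs F \<longleftrightarrow>
      (u, v) \<in> parcs F \<and> (v, u) \<in> parcs F \<and> c {u, v} = (u, v)"
  proof
    assume "(u, v) \<in> c ` bidirectional_pairs F"
    then obtain e where e: "e \<in> bidirectional_pairs F" "c e = (u, v)"
      by auto
    then have "e = {u, v}"
      using c by fastforce
    then show "(u, v) \<in> parcs F \<and> (v, u) \<in> parcs F \<and> c {u, v} = (u, v)"
      using e by (auto simp: bidirectional_pairs_def doubleton_eq_iff)
  next
    assume "(u, v) \<in> parcs F \<and> (v, u) \<in> parcs F \<and> c {u, v} = (u, v)"
    then show "(u, v) \<in> c ` bidirectional_pairs F"
      by (intro image_eqI[of _ _ "{u, v}"]) (auto simp: bidirectional_pairs_def)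
  qed
  then show ?thesis
    by (auto simp: resolve_def)
qed

lemma choice_cases:
  assumes "c \<in> choices F" "{u, v} \<in> bidirectional_pairs F"
  shows "c {u, v} = (u, v) \<or> c {u, v} = (v, u)"
proof -
  have "c {u, v} \<in> orientations {u, v}"
    using assms by (auto simp: choices_def PiE_dflt_def)
  then show ?thesis
    by (auto simp: orientations_def doubleton_eq_iff)
qed

lemma tournament_resolve:
  assumes "semi_complete F" "c \<in> choices F"
  shows "tournament (resolve F c)"
proof -
  have F: "pair_digraph F"
    using assms(1) by (simp add: semi_complete_def)
  interpret pair_digraph F by (rule F)
  have sub: "parcs (resolve F c) \<subseteq> parcs F"
    using arc_resolve_iff[OF assms(2)] by auto
  have "finite (parcs (resolve F c))"
    using sub pair_finite_arcs finite_subset by blast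
  moreover have "u \<in> pverts F \<and> v \<in> pverts F \<and> u \<noteq> v" if "(u, v) \<in> parcs (resolve F c)" for u v
    using that sub in_arcsD1 in_arcsD2 no_loops' by blast
  ultimately have "pair_digraph (resolve F c)"
    using pair_finite_verts by unfold_locales auto
  moreover have "(u, v) \<in> parcs (resolve F c) \<longleftrightarrow> (v, u) \<notin> parcs (resolve F c)"
    if uv: "u \<in> pverts F" "v \<in> pverts F" "u \<noteq> v" for u v
  proof (cases "(u, v) \<in> parcs F \<and> (v, u) \<in> parcs F")
    case True
    then have "{u, v} \<in> bidirectional_pairs F"
      by (auto simp: bidirectional_pairs_def)
    then show ?thesis
      using True uv(3) choice_cases[OF assms(2), of u v] arc_resolve_iff[OF assms(2)]
      by (auto simp: insert_commute)
  next
    case False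
    moreover have "(u, v) \<in> parcs F \<or> (v, u) \<in> parcs F"
      using assms(1) uv by (auto simp: semi_complete_def)
    ultimately show ?thesis
      using arc_resolve_iff[OF assms(2)] by auto
  qed
  ultimately show ?thesis
    unfolding tournament_def pverts_resolve by blast
qed

text \<open>
  If \<open>X\<close> is homogeneous, then for a vertex \<open>v\<close> outside \<open>X\<close>
  the direction of a single pair between \<open>v\<close> and \<open>X\<close> determines the
  direction of all others. So fix a reference vertex \<open>r v\<close> in \<open>X\<close>, not
  joined to \<open>v\<close> by a bidirectional pair if that is possible. The choices on the
  remaining bidirectional pairs \<open>{x, v}\<close> with \<open>x \<noteq> r v\<close> are then
  forced by the choices elsewhere, and each of them costs a factor 1/2. Only vertices
  \<open>v\<close> that are joined bidirectionally to all of \<open>X\<close> lose a pair to their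
  reference vertex, and as \<open>X\<close> has another element, at least half of the crossing
  pairs stay determined. Counting choices this way avoids any conditioning.
\<close>

lemma prob_homogeneous_le:
  fixes F :: "'a pair_pre_digraph"
  assumes F: "semi_complete F" and X: "X \<subseteq> pverts F" "2 \<le> card X"
  defines "cross \<equiv> parcs (bidirectional_graph F) \<inter> X \<times> (pverts F - X)"
  shows "measure_pmf.prob (random_tournament F) {G. homogeneous_set G X} \<le> 2 powr (- real (card cross) / 2)"
proof -
  let ?B = "bidirectional_pairs F"
  have dig: "pair_digraph F"
    using F by (simp add: semi_complete_def)
  interpret pair_digraph F by (rule dig)
  note finB = finite_bidirectional_pairs[OF dig]
  have fin_cross: "finite cross"
    using pair_finite_arcs by (auto simp: cross_def bidirectional_graph_def)
  have cross_iff: "(x, v) \<in> cross \<longleftrightarrow> x \<in> X \<and> v \<in> pverts F - X \<and> (x, v) \<in> parcs F \<and> (v, x) \<in> parcs F"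
    for x v by (auto simp: cross_def bidirectional_graph_def)
  have "\<exists>r\<in>X. (\<exists>x\<in>X. (x, v) \<notin> cross) \<longrightarrow> (r, v) \<notin> cross" for v
    using X(2) by (cases "X = {}") auto
  then obtain r where r: "\<And>v. r v \<in> X" "\<And>v x. x \<in> X \<Longrightarrow> (x, v) \<notin> cross \<Longrightarrow> (r v, v) \<notin> cross"
    by metis
  define det where "det = {(x, v) \<in> cross. x \<noteq> r v}"
  have fin_det: "finite det"
    using fin_cross by (auto simp: det_def intro: finite_subset)
  have half: "card cross \<le> 2 * card det"
  proof -
    \<comment> \<open>A lost pair \<open>{r v, v}\<close> is matched with the determined pair \<open>{s v, v}\<close> at the same \<open>v\<close>.\<close>
    have "\<exists>s\<in>X. s \<noteq> r v" for v
    proof (rule ccontr)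
      assume "\<not> (\<exists>s\<in>X. s \<noteq> r v)"
      then have "X \<subseteq> {r v}"
        by auto
      from card_mono[OF _ this] X(2) show False
        by simp
    qed
    then obtain s where s: "\<And>v. s v \<in> X" "\<And>v. s v \<noteq> r v"
      by metis
    have "inj_on (\<lambda>(x, v). (s v, v)) (cross - det)"
      by (auto simp: inj_on_def det_def)
    moreover have "(\<lambda>(x, v). (s v, v)) ` (cross - det) \<subseteq> det"
      using r(2) s by (auto simp: det_def)
    ultimately have "card (cross - det) \<le> card det"
      using fin_det by (rule card_inj_on_le)
    moreover have "card cross \<le> card (cross - det) + card det"
    proof -
      have "(cross - det) \<union> det = cross"
        by (auto simp: det_def)
      then show ?thesis
        using card_Un_le[of "cross - det" det] by simp
    qed
    ultimately show ?thesis
      by linarith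
  qed
  define D where "D = (\<lambda>(x, v). {x, v}) ` det"
  have "inj_on (\<lambda>(x, v). {x, v}) det"
    by (auto simp: inj_on_def det_def cross_iff doubleton_eq_iff)
  then have card_D: "card D = card det"
    by (simp add: D_def card_image)
  have D_sub: "D \<subseteq> ?B"
    by (auto simp: D_def det_def cross_iff bidirectional_pairs_def)
  \<comment> \<open>Forgetting the choices on \<open>D\<close> is injective on the event \<open>\<E>\<close>.\<close>
  define \<E> where "\<E> = {c \<in> choices F. resolve F c \<in> {G. homogeneous_set G X}}"
  define \<rho> where "\<rho> c e = (if e \<in> ?B - D then c e else undefined)" for c :: "'a set \<Rightarrow> 'a \<times> 'a" and e
  have agree: "c e = c' e"
    if c: "c \<in> \<E>" and c': "c' \<in> \<E>" and eq: "\<And>e. e \<in> ?B - D \<Longrightarrow> c e = c' e" and e: "e \<in> D" for c c' e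
  proof -
    obtain x v where xv: "e = {x, v}" "(x, v) \<in> cross" "x \<noteq> r v"
      using e by (auto simp: D_def det_def)
    have v: "x \<in> X" "v \<in> pverts F" "v \<notin> X" and x_bi: "(x, v) \<in> parcs F" "(v, x) \<in> parcs F"
      using xv(2) by (auto simp: cross_iff)
    have refl: "(x, v) \<in> parcs (resolve F c) \<longleftrightarrow> (r v, v) \<in> parcs (resolve F c)" if "c \<in> \<E>" for c
    proof -
      have t: "tournament (resolve F c)"
        using that F by (intro tournament_resolve) (auto simp: \<E>_def)
      have *: "(y, v) \<in> parcs (resolve F c) \<longleftrightarrow> (v, y) \<notin> parcs (resolve F c)" if "y \<in> X" for y
        using t that v X(1) by (auto simp: tournament_def)
      have "(\<forall>y\<in>X. (v, y) \<in> parcs (resolve F c)) \<or> (\<forall>y\<in>X. (y, v) \<in> parcs (resolve F c))"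
        using that v by (auto simp: \<E>_def homogeneous_set_def)
      then show ?thesis
        using * v(1) r(1)[of v] by blast
    qed
    \<comment> \<open>The pair of \<open>v\<close> and its reference vertex is never forgotten.\<close>
    have "{r v, v} \<notin> D"
      using v(3) r(1)[of v] by (auto simp: D_def det_def cross_iff doubleton_eq_iff)
    then have "c {r v, v} = c' {r v, v}" if "(r v, v) \<in> parcs F" "(v, r v) \<in> parcs F"
      using that by (intro eq) (auto simp: bidirectional_pairs_def)
    then have "(r v, v) \<in> parcs (resolve F c) \<longleftrightarrow> (r v, v) \<in> parcs (resolve F c')"
      using c c' arc_resolve_iff[of c F "r v" v] arc_resolve_iff[of c' F "r v" v]
      by (auto simp: \<E>_def)
    then have "(x, v) \<in> parcs (resolve F c) \<longleftrightarrow> (x, v) \<in> parcs (resolve F c')"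
      using refl c c' by blast
    then have "c {x, v} = (x, v) \<longleftrightarrow> c' {x, v} = (x, v)"
      using arc_resolve_iff[of c F x v] arc_resolve_iff[of c' F x v] c c' x_bi by (auto simp: \<E>_def)
    moreover have "{x, v} \<in> ?B"
      using e D_sub xv(1) by auto
    moreover have "c \<in> choices F" "c' \<in> choices F"
      using c c' by (simp_all add: \<E>_def)
    ultimately show ?thesis
      unfolding xv(1) using choice_cases by metis
  qed
  have "inj_on \<rho> \<E>"
  proof (rule inj_onI, rule ext)
    fix c c' e assume c: "c \<in> \<E>" "c' \<in> \<E>" "\<rho> c = \<rho> c'"
    have eq: "c e = c' e" if "e \<in> ?B - D" for e
      using fun_cong[OF c(3), of e] that by (simp add: \<rho>_def)
    show "c e = c' e"
    proof (cases "e \<in> ?B")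
      case True
      then show ?thesis
        using eq agree[OF c(1,2) eq] by blast
    next
      case False
      then show ?thesis
        using c(1,2) by (simp add: \<E>_def choices_def PiE_dflt_def)
    qed
  qed
  moreover have "\<rho> ` \<E> \<subseteq> PiE_dflt (?B - D) undefined (\<lambda>e. orientations e)"
    by (auto simp: \<rho>_def \<E>_def choices_def PiE_dflt_def)
  moreover have "finite (PiE_dflt (?B - D) undefined (\<lambda>e. orientations e))"
    using finB orientations_of_pair[OF _ dig] by (intro finite_PiE_dflt) auto
  ultimately have "card \<E> \<le> card (PiE_dflt (?B - D) undefined (\<lambda>e. orientations e))"
    by (rule card_inj_on_le)
  also have "\<dots> = (\<Prod>e\<in>?B - D. card (orientations e))"
    using finB orientations_of_pair(2)[OF _ dig] by (intro card_PiE_dflt) auto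
  also have "\<dots> = (\<Prod>e\<in>?B - D. 2)"
    using orientations_of_pair[OF _ dig] by (intro prod.cong) auto
  also have "\<dots> = 2 ^ card (?B - D)"
    by simp
  finally have "card \<E> \<le> 2 ^ card (?B - D)" .
  then have "real (card \<E>) \<le> 2 ^ card (?B - D)"
    by (metis of_nat_le_iff of_nat_numeral of_nat_power)
  moreover have "card ?B = card (?B - D) + card det"
    using D_sub finB card_D by (metis add.commute card_Diff_subset card_mono finite_subset le_add_diff_inverse)
  ultimately have "measure_pmf.prob (random_tournament F) {G. homogeneous_set G X} \<le> 1 / 2 ^ card det"
    unfolding prob_random_tournament[OF dig] \<E>_def[symmetric] by (simp add: field_simps power_add)
  also have "\<dots> = 2 powr (- real (card det))"
    by (simp add: powr_minus powr_realpow divide_simps)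
  also have "\<dots> \<le> 2 powr (- real (card cross) / 2)"
    using half by (intro powr_mono) auto
  finally show ?thesis .
qed

text \<open>
  Summed over all subsets, \<open>q ^ card X\<close> gives \<open>(1 + q) ^ card V\<close>, which
  is at most \<open>exp (card V * q)\<close>.
\<close>

lemma sum_power_card_nonempty_le:
  fixes q :: real
  assumes "finite V" "0 \<le> q" "real (card V) * q \<le> 1 / 8"
  shows "(\<Sum>X\<in>Pow V - {{}}. q ^ card X) \<le> 1 / 4"
proof -
  let ?y = "real (card V) * q"
  have "(\<Sum>X\<in>Pow V. q ^ card X) = (\<Prod>x\<in>V. q + 1)"
    using assms(1) by (subst prod_add) auto
  also have "\<dots> = (1 + q) ^ card V"
    by (simp add: add.commute)
  also have "\<dots> \<le> exp q ^ card V"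
    using assms(2) by (intro power_mono) (auto simp: add.commute)
  also have "\<dots> = exp ?y"
    by (simp add: exp_of_nat_mult)
  also have "\<dots> \<le> 1 + ?y + ?y\<^sup>2"
    using assms by (intro exp_bound) auto
  also have "\<dots> \<le> 1 + 1 / 8 + (1 / 8)\<^sup>2"
    using assms by (intro add_mono power_mono) auto
  also have "\<dots> \<le> 1 + 1 / 4"
    by (simp add: power2_eq_square)
  finally have "(\<Sum>X\<in>Pow V. q ^ card X) \<le> 1 + 1 / 4" .
  moreover have "(\<Sum>X\<in>Pow V. q ^ card X) = 1 + (\<Sum>X\<in>Pow V - {{}}. q ^ card X)"
    using assms(1) by (subst sum.remove[of _ "{}"]) auto
  ultimately show ?thesis
    by simp
qed

text \<open>
  Expansion bounds the cut between \<open>X\<close> and its complement from below by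
  \<open>d\<close> times the size of the smaller side. The right-hand side adds the terms of both
  sides, so that the union bound over \<open>X\<close> splits into two sums of the same shape,
  without a case distinction on which side is smaller.
\<close>

lemma prob_homogeneous_expander_le:
  assumes F: "semi_complete_expander d F" and n: "n = card (pverts F)"
    and d: "8 * log 2 (real n) \<le> d" and X: "X \<subseteq> pverts F" "1 < card X" "card X < n"
  shows "measure_pmf.prob (random_tournament F) {G. homogeneous_set G X}
    \<le> (1 / real n ^ 4) ^ card X + (1 / real n ^ 4) ^ card (pverts F - X)"
proof -
  let ?V = "pverts F" and ?U = "parcs (bidirectional_graph F)" and ?q = "1 / real n ^ 4"
  have sc: "semi_complete F" and ex: "expander d (bidirectional_graph F)"
    using F by (auto simp: semi_complete_expander_def)
  have n2: "2 \<le> n"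
    using X by linarith
  have fin: "finite ?V"
    using n n2 by (metis card.infinite not_numeral_le_zero)
  have out: "d * real (card S) \<le> real (card (?U \<inter> S \<times> (?V - S)))"
    if "S \<subseteq> ?V" "1 \<le> card S" "2 * card S \<le> n" for S
    using ex that unfolding expander_def n by (auto simp: bidirectional_graph_def)
  have small: "2 powr (- real e / 2) \<le> ?q ^ t" if "d * real t \<le> real e" for e t
  proof -
    have "8 * log 2 (real n) * real t \<le> real e"
      using mult_right_mono[OF d, of "real t"] that by simp
    then have "2 powr (- real e / 2) \<le> 2 powr (log 2 (real n) * (- real (4 * t)))"
      by (intro powr_mono) (auto simp: algebra_simps)
    also have "\<dots> = (2 powr log 2 (real n)) powr (- real (4 * t))"
      by (simp only: powr_powr)
    also have "\<dots> = real n powr (- real (4 * t))"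
      using n2 by simp
    also have "\<dots> = 1 / real n ^ (4 * t)"
      using n2 by (simp only: powr_minus powr_realpow divide_inverse)
    finally show ?thesis
      by (simp add: power_mult power_one_over)
  qed
  have prob: "measure_pmf.prob (random_tournament F) {G. homogeneous_set G X}
      \<le> 2 powr (- real (card (?U \<inter> X \<times> (?V - X))) / 2)"
    using X by (intro prob_homogeneous_le sc) auto
  have q0: "0 \<le> ?q ^ m" for m
    by simp
  show ?thesis
  proof (cases "2 * card X \<le> n")
    case True
    then show ?thesis
      using prob small[OF out[of X]] X q0[of "card (?V - X)"] by linarith
  next
    case False
    have card: "card (?V - X) = n - card X"
      using X fin n by (simp add: card_Diff_subset finite_subset)
    have "?U \<inter> (?V - X) \<times> (?V - (?V - X)) = (?U \<inter> X \<times> (?V - X))\<inverse>"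
      using X(1) by (auto simp: bidirectional_graph_def)
    then have "card (?U \<inter> (?V - X) \<times> (?V - (?V - X))) = card (?U \<inter> X \<times> (?V - X))"
      by simp
    then have "d * real (card (?V - X)) \<le> real (card (?U \<inter> X \<times> (?V - X)))"
      using out[of "?V - X"] False card X by simp
    from small[OF this] show ?thesis
      using prob q0[of "card X"] by linarith
  qed
qed

text \<open>
  Union bound over the possible homogeneous sets. The constant 8 makes a smaller side of size
  \<open>t\<close> contribute \<open>n ^ (- 4 * t)\<close>, which beats the at most
  \<open>n ^ t\<close> sets with that smaller side.
\<close>

lemma prob_not_prime_le:
  assumes F: "semi_complete_expander d F" and d: "8 * log 2 (real (card (pverts F))) \<le> d"
  shows "measure_pmf.prob (random_tournament F) {G. \<not> prime_tournament G} \<le> 1 / 2"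
proof -
  let ?V = "pverts F" and ?P = "measure_pmf.prob (random_tournament F)"
  define n where "n = card ?V"
  let ?q = "1 / real n ^ 4"
  define \<X> where "\<X> = {X. X \<subseteq> ?V \<and> 1 < card X \<and> card X < n}"
  have sc: "semi_complete F" and n2: "2 \<le> n"
    using F by (auto simp: semi_complete_expander_def expander_def bidirectional_graph_def n_def)
  then have dig: "pair_digraph F"
    by (simp add: semi_complete_def)
  have fin: "finite ?V"
    using n2 n_def by (metis card.infinite not_numeral_le_zero)
  have X_sub: "\<X> \<subseteq> Pow ?V - {{}}" "\<X> \<subseteq> Pow ?V - {?V}"
    by (auto simp: \<X>_def n_def)
  have fin_X: "finite \<X>"
    using X_sub(1) fin by (meson finite_Diff finite_Pow_iff finite_subset)
  have supp: "set_pmf (random_tournament F) \<inter> {G. \<not> prime_tournament G} \<subseteq> (\<Union>X\<in>\<X>. {G. homogeneous_set G X})"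
  proof
    fix G assume "G \<in> set_pmf (random_tournament F) \<inter> {G. \<not> prime_tournament G}"
    then obtain c where c: "c \<in> choices F" "G = resolve F c" "\<not> prime_tournament G"
      using choices_finite_card[OF dig] by (auto simp: random_tournament_eq[OF dig])
    then have "tournament G"
      using tournament_resolve[OF sc] by simp
    then obtain X where "homogeneous_set G X" "1 < card X" "card X < card (pverts G)"
      using c(3) by (auto simp: prime_tournament_def)
    moreover have "pverts G = ?V"
      by (simp add: c)
    ultimately show "G \<in> (\<Union>X\<in>\<X>. {G. homogeneous_set G X})"
      by (auto simp: \<X>_def n_def homogeneous_set_def)
  qed
  have "?P {G. \<not> prime_tournament G} = ?P (set_pmf (random_tournament F) \<inter> {G. \<not> prime_tournament G})"
    by (subst Int_commute) (simp only: measure_Int_set_pmf)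
  also have "\<dots> \<le> ?P (\<Union>X\<in>\<X>. {G. homogeneous_set G X})"
    using supp by (intro measure_pmf.finite_measure_mono) auto
  also have "\<dots> \<le> (\<Sum>X\<in>\<X>. ?P {G. homogeneous_set G X})"
    using fin_X by (intro measure_pmf.finite_measure_subadditive_finite) auto
  also have "\<dots> \<le> (\<Sum>X\<in>\<X>. ?q ^ card X + ?q ^ card (?V - X))"
    using prob_homogeneous_expander_le[OF F n_def] d
    by (intro sum_mono) (auto simp: \<X>_def n_def)
  also have "\<dots> = (\<Sum>X\<in>\<X>. ?q ^ card X) + (\<Sum>X\<in>\<X>. ?q ^ card (?V - X))"
    by (rule sum.distrib)
  also have "\<dots> \<le> (\<Sum>X\<in>Pow ?V - {{}}. ?q ^ card X) + (\<Sum>X\<in>Pow ?V - {?V}. ?q ^ card (?V - X))"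
    using X_sub fin by (intro add_mono sum_mono2) auto
  also have "(\<Sum>X\<in>Pow ?V - {?V}. ?q ^ card (?V - X)) = (\<Sum>X\<in>Pow ?V - {{}}. ?q ^ card X)"
    by (rule sum.reindex_bij_witness[of _ "\<lambda>X. ?V - X" "\<lambda>X. ?V - X"])
      (auto simp: double_diff)
  also have "(\<Sum>X\<in>Pow ?V - {{}}. ?q ^ card X) + (\<Sum>X\<in>Pow ?V - {{}}. ?q ^ card X) \<le> 1 / 4 + 1 / 4"
  proof -
    have "real n * ?q = 1 / real n ^ 3"
      using n2 by (simp add: power_numeral_reduce)
    also have "\<dots> \<le> 1 / 2 ^ 3"
      using n2 by (intro divide_left_mono power_mono) auto
    finally have "real (card ?V) * ?q \<le> 1 / 8"
      by (simp add: n_def)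
    then show ?thesis
      using fin by (intro add_mono sum_power_card_nonempty_le) auto
  qed
  finally show ?thesis
    by simp
qed


section \<open>Cycles as cyclic sequences\<close>

text \<open>
  Cycles as sequences of vertices indexed modulo \<open>m\<close>. Unlike arc lists they can be
  composed with a map of vertices, which is how a cycle is transported to another graph.
\<close>

definition cyclic_seq :: "('a \<Rightarrow> 'a \<Rightarrow> bool) \<Rightarrow> nat \<Rightarrow> (nat \<Rightarrow> 'a) \<Rightarrow> bool" where
  "cyclic_seq E m v \<longleftrightarrow> 0 < m \<and> inj_on v {..<m} \<and> (\<forall>i<m. E (v i) (v (Suc i mod m)))"

lemma cas_consecutive:
  assumes "pre_digraph.cas D u p w" "tail D = fst" "head D = snd" "p \<noteq> []"
  shows "fst (p ! 0) = u" "snd (last p) = w" "Suc i < length p \<Longrightarrow> snd (p ! i) = fst (p ! Suc i)"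
proof -
  have "p \<noteq> [] \<longrightarrow> fst (p ! 0) = u \<and> snd (last p) = w \<and>
      (\<forall>i. Suc i < length p \<longrightarrow> snd (p ! i) = fst (p ! Suc i))"
    using assms(1)
  proof (induction p arbitrary: u)
    case (Cons e p)
    have "p \<noteq> [] \<longrightarrow> fst (p ! 0) = snd e \<and> snd (last p) = w \<and>
        (\<forall>i. Suc i < length p \<longrightarrow> snd (p ! i) = fst (p ! Suc i))"
      using Cons.prems by (intro Cons.IH) (simp add: pre_digraph.cas.simps assms)
    moreover have "fst e = u" "p = [] \<Longrightarrow> snd e = w"
      using Cons.prems by (auto simp: pre_digraph.cas.simps assms)
    ultimately show ?case
      by (auto simp: nth_Cons' gr0_conv_Suc)
  qed simp
  then show "fst (p ! 0) = u" "snd (last p) = w"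
    "Suc i < length p \<Longrightarrow> snd (p ! i) = fst (p ! Suc i)"
    using assms(4) by auto
qed

lemma cycle_imp_cyclic_seq:
  assumes "pre_digraph.cycle D p" "tail D = fst" "head D = snd"
  shows "cyclic_seq (\<lambda>u v. (u, v) \<in> arcs D) (length p) (\<lambda>i. snd (p ! i))"
proof -
  obtain u where u: "set p \<subseteq> arcs D" "pre_digraph.cas D u p u"
      "distinct (tl (pre_digraph.awalk_verts D u p))" "p \<noteq> []"
    using assms(1) unfolding pre_digraph.cycle_def pre_digraph.awalk_def by auto
  note walk = cas_consecutive[OF u(2) assms(2,3) u(4)]
  have "distinct (map snd p)"
    using u(3,4) pre_digraph.awalk_verts_conv'[OF u(2)] assms by simp
  then have "inj_on (\<lambda>i. snd (p ! i)) {..<length p}"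
    by (auto simp: inj_on_def distinct_conv_nth) 
  moreover have "(snd (p ! i), snd (p ! (Suc i mod length p))) \<in> arcs D" if "i < length p" for i
  proof (cases "Suc i < length p")
    case True
    then show ?thesis
      using walk(3)[OF True] u(1) by (metis mod_less nth_mem prod.collapse subsetD)
  next
    case False
    then have "Suc i = length p"
      using that by simp
    then have "Suc i mod length p = 0" "snd (p ! i) = u"
      using walk(2) u(4) by (simp_all add: last_conv_nth flip: \<open>Suc i = length p\<close>)
    then show ?thesis
      using walk(1) u(1,4) by (metis length_greater_0_conv nth_mem prod.collapse subsetD)
  qed
  ultimately show ?thesis
    using u(4) by (auto simp: cyclic_seq_def)
qed

lemma pcas_map_upt:
  "a \<le> b \<Longrightarrow> pcas (f a) (map (\<lambda>i. (f i, f (Suc i))) [a..<b]) (f b)"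
proof (induction "b - a" arbitrary: a)
  case (Suc d)
  then show ?case
    by (auto simp: upt_conv_Cons)
qed simp

lemma cyclic_seq_imp_cycle:
  assumes "cyclic_seq (\<lambda>u v. (u, v) \<in> parcs U) m v" "pair_wf_digraph U"
  shows "\<exists>p. pre_digraph.cycle (with_proj U) p \<and> length p = m"
proof -
  define f where "f i = v (i mod m)" for i
  define p where "p = map (\<lambda>i. (f i, f (Suc i))) [0..<m]"
  have m: "0 < m" and inj: "inj_on v {..<m}"
    and arc: "\<And>i. i < m \<Longrightarrow> (v i, v (Suc i mod m)) \<in> parcs U"
    using assms(1) by (auto simp: cyclic_seq_def)
  have arcs: "set p \<subseteq> parcs U"
    using arc by (auto simp: p_def f_def)
  have "f 0 \<in> pverts U"
    using arc[of 0] m pair_wf_digraph.in_arcsD1[OF assms(2)] by (auto simp: f_def)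
  moreover have cas: "pcas (f 0) p (f 0)"
    using pcas_map_upt[of 0 m f] by (simp add: p_def f_def)
  moreover have "distinct (tl (pawalk_verts (f 0) p))"
  proof -
    have "pawalk_verts (f 0) p = fst (hd p) # map snd p"
      using pre_digraph.awalk_verts_conv'[of "with_proj U" "f 0" p "f 0"] cas m
      by (simp add: cas_with_proj_eq awalk_verts_with_proj_eq p_def)
    moreover have "inj_on (\<lambda>i. f (Suc i)) {..<m}"
    proof (rule inj_onI)
      fix i j assume "i \<in> {..<m}" "j \<in> {..<m}" "f (Suc i) = f (Suc j)"
      then have "Suc i mod m = Suc j mod m"
        using inj m by (auto simp: f_def inj_on_def)
      then show "i = j"
        using \<open>i \<in> {..<m}\<close> \<open>j \<in> {..<m}\<close>
        by (metis Suc_lessI lessThan_iff mod_Suc mod_less mod_self nat.inject nat.distinct(1))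
    qed
    ultimately show ?thesis
      by (simp add: p_def distinct_map comp_def atLeast0LessThan)
  qed
  ultimately have "pre_digraph.cycle (with_proj U) p"
    using arcs m unfolding pre_digraph.cycle_def pre_digraph.awalk_def
    by (auto simp: cas_with_proj_eq awalk_verts_with_proj_eq p_def intro!: exI[of _ "f 0"])
  then show ?thesis
    by (auto simp: p_def)
qed

lemma undirected_forest_iff:
  "undirected_forest U \<longleftrightarrow>
    pair_graph U \<and> (\<forall>m v. cyclic_seq (\<lambda>u w. (u, w) \<in> parcs U) m v \<longrightarrow> m < 3)"
proof -
  have "(\<exists>p. pre_digraph.cycle (with_proj U) p \<and> 3 \<le> length p) \<longleftrightarrow>
      (\<exists>m v. cyclic_seq (\<lambda>u w. (u, w) \<in> parcs U) m v \<and> 3 \<le> m)" if "pair_wf_digraph U"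
    using cycle_imp_cyclic_seq[of "with_proj U"] cyclic_seq_imp_cycle[OF _ that]
    by (fastforce simp del: not_less)
  moreover have "pair_graph U \<Longrightarrow> pair_wf_digraph U"
    by (intro pair_digraph.pair_wf_digraph) (simp add: pair_graph_def)
  ultimately show ?thesis
    unfolding undirected_forest_def by (metis not_less)
qed


section \<open>Tournament forests built from copies of a forest pattern\<close>

text \<open>
  The \<open>2k \<times> 2k\<close> matrix with blocks \<open>M, I\<close> in the upper and
  \<open>I, 0\<close> in the lower half: every row and column of \<open>M\<close> gets a private
  neighbour that has no other neighbour.
\<close>

definition with_pendants :: "nat \<Rightarrow> (nat \<Rightarrow> nat \<Rightarrow> bool) \<Rightarrow> nat \<Rightarrow> nat \<Rightarrow> bool" where
  "with_pendants k M x y \<longleftrightarrow> (x < k \<and> y < k \<and> M x y) \<or> y = x + k \<or> x = y + k"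

text \<open>The block diagonal matrix all of whose blocks are \<open>with_pendants k M\<close>.\<close>

definition block_copies :: "nat \<Rightarrow> (nat \<Rightarrow> nat \<Rightarrow> bool) \<Rightarrow> nat \<Rightarrow> nat \<Rightarrow> bool" where
  "block_copies k M i j \<longleftrightarrow> i div (2 * k) = j div (2 * k) \<and> with_pendants k M (i mod (2 * k)) (j mod (2 * k))"

text \<open>
  Vertices below \<open>N\<close> are the rows of \<open>B\<close>, the others its columns. All
  arcs increase, except that an entry 1 of \<open>B\<close> reverses the arc between its row and
  its column.
\<close>

definition pattern_tournament :: "nat \<Rightarrow> (nat \<Rightarrow> nat \<Rightarrow> bool) \<Rightarrow> nat pair_pre_digraph" where
  "pattern_tournament N B = \<lparr> pverts = {..<2 * N},
     parcs = {(u, v). u < v \<and> v < 2 * N \<and> \<not> (u < N \<and> N \<le> v \<and> B u (v - N))} \<union>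
             {(u, v). v < N \<and> N \<le> u \<and> u < 2 * N \<and> B v (u - N)} \<rparr>"

lemma tournament_pattern_tournament: "tournament (pattern_tournament N B)"
proof -
  have "parcs (pattern_tournament N B) \<subseteq> {..<2 * N} \<times> {..<2 * N}"
    by (auto simp: pattern_tournament_def)
  then have "finite (parcs (pattern_tournament N B))"
    by (rule finite_subset) auto
  then have "pair_digraph (pattern_tournament N B)"
    by unfold_locales (auto simp: pattern_tournament_def)
  then show ?thesis
    by (auto simp: tournament_def pattern_tournament_def)
qed

lemma transitive_set_if_increasing:
  fixes G :: "nat pair_pre_digraph"
  assumes "S \<subseteq> pverts G" "\<And>u v. (u, v) \<in> parcs G \<Longrightarrow> u \<in> S \<Longrightarrow> v \<in> S \<Longrightarrow> u < v"
  shows "transitive_set G S"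
proof -
  have False if "pre_digraph.cycle (with_proj G \<restriction> S) p" for p
  proof -
    let ?m = "length p" and ?v = "\<lambda>i. snd (p ! i)"
    have "cyclic_seq (\<lambda>u v. (u, v) \<in> arcs (with_proj G \<restriction> S)) ?m ?v"
      using that by (rule cycle_imp_cyclic_seq) (auto simp: induce_subgraph_def)
    then have m: "0 < ?m" and step: "\<And>i. i < ?m \<Longrightarrow> ?v i < ?v (Suc i mod ?m)"
      using assms(2) by (auto simp: cyclic_seq_def induce_subgraph_def)
    have "i < ?m \<Longrightarrow> ?v 0 \<le> ?v i" for i
    proof (induction i)
      case (Suc i)
      then show ?case
        using step[of i] by simp
    qed simp
    from this[of "?m - 1"] step[of "?m - 1"] m show False
      by simp
  qed
  then show ?thesis
    using assms(1) by (auto simp: transitive_set_def)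
qed

text \<open>
  A cycle of length at least 3 leaves each of its vertices along a different edge from the one
  along which it arrives, so it avoids the private neighbours. It stays within one block, and
  within a block the position maps the remaining vertices injectively to the graph of
  \<open>M\<close>, where it would be a cycle.
\<close>

lemma tournament_forest_block_copies:
  fixes t :: nat
  assumes forest: "undirected_forest (bipartite_graph (Inl ` {..<k}) (Inr ` {..<k})
       (\<lambda>x y. \<exists>i j. x = Inl i \<and> y = Inr j \<and> M i j))"
  defines "N \<equiv> t * (2 * k)"
  shows "tournament_forest (pattern_tournament N (block_copies k M))"
proof -
  let ?H = "pattern_tournament N (block_copies k M)"
  let ?L = "{..<N}" and ?R = "{N..<2 * N}"
  define E where "E = {(l, r). l < N \<and> N \<le> r \<and> r < 2 * N \<and> block_copies k M l (r - N)}"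
  define U where "U = \<lparr>pverts = ?L \<union> ?R, parcs = E \<union> E\<inverse>\<rparr>"
  have U: "bipartite_graph ?L ?R (\<lambda>l r. (r, l) \<in> parcs ?H) = U"
  proof -
    have "{(l, r). l \<in> ?L \<and> r \<in> ?R \<and> (r, l) \<in> parcs ?H} = E"
      by (auto simp: E_def pattern_tournament_def)
    then show ?thesis
      by (simp add: bipartite_graph_def U_def)
  qed
  have "E \<subseteq> {..<2 * N} \<times> {..<2 * N}"
    by (auto simp: E_def)
  then have "finite E"
    by (rule finite_subset) auto
  then have graph: "pair_graph U"
    by unfold_locales (auto simp: U_def E_def symmetric_def sym_def)
  define idx where "idx u = (if u < N then u else u - N)" for u
  define pos where "pos u = idx u mod (2 * k)" for u
  define blk where "blk u = idx u div (2 * k)" for u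
  define g where "g u = (if u < N then Inl (pos u) else Inr (pos u) :: nat + nat)" for u
  have idx_split: "idx u = blk u * (2 * k) + pos u" for u
    unfolding blk_def pos_def by (simp only: div_mult_mod_eq)
  have adj: "blk u = blk w \<and> (u < N \<longleftrightarrow> \<not> w < N) \<and> u < 2 * N \<and> w < 2 * N \<and> pos u < 2 * k \<and> pos w < 2 * k \<and>
      (pos w = pos u + k \<or> pos u = pos w + k \<or>
        pos u < k \<and> pos w < k \<and> (if u < N then M (pos u) (pos w) else M (pos w) (pos u)))"
    if "(u, w) \<in> parcs U" for u w
  proof -
    have "0 < k"
      using that by (cases k) (auto simp: U_def E_def N_def)
    then show ?thesis
      using that by (auto simp: U_def E_def block_copies_def with_pendants_def idx_def pos_def blk_def)
  qed
  \<comment> \<open>A vertex at a position from \<open>k\<close> on is a private neighbour and has only one neighbour itself.\<close>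
  have leaf: "w = w'" if "(u, w) \<in> parcs U" "(u, w') \<in> parcs U" "k \<le> pos u" for u w w'
  proof -
    have "pos w = pos u - k" "pos w' = pos u - k" "blk w = blk u" "blk w' = blk u"
      using adj[OF that(1)] adj[OF that(2)] that(3) by auto
    then have "idx w = idx w'"
      using idx_split by metis
    moreover have "(w < N) = (w' < N)"
      using adj[OF that(1)] adj[OF that(2)] by auto
    ultimately show ?thesis
      by (auto simp: idx_def split: if_splits)
  qed
  have "m < 3" if cyc: "cyclic_seq (\<lambda>u w. (u, w) \<in> parcs U) m v" for m v
  proof (rule ccontr)
    assume "\<not> m < 3"
    then have m: "3 \<le> m"
      by simp
    have inj: "inj_on v {..<m}" and arc: "\<And>i. i < m \<Longrightarrow> (v i, v (Suc i mod m)) \<in> parcs U"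
      using cyc by (auto simp: cyclic_seq_def)
    have arc_sym: "(w, u) \<in> parcs U" if "(u, w) \<in> parcs U" for u w
      using that by (auto simp: U_def)
    have core: "pos (v j) < k" if "j < m" for j
    proof (rule ccontr)
      assume "\<not> pos (v j) < k"
      obtain i where i: "i < m" "Suc i mod m = j"
      proof (cases j)
        case 0
        then show ?thesis
          using m that[of "m - 1"] by simp
      next
        case (Suc i)
        then show ?thesis
          using \<open>j < m\<close> that[of i] by simp
      qed
      let ?j = "Suc j mod m"
      have "v i = v ?j"
        using leaf[of "v j" "v i" "v ?j"] arc[of i] arc[of j] arc_sym i that \<open>\<not> pos (v j) < k\<close>
        by simp
      then have "i = ?j"
        using inj i(1) m by (auto simp: inj_on_def)
      then show False
        using i(2) \<open>j < m\<close> m by (auto simp: mod_Suc split: if_splits)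
    qed
    have blk_eq: "i < m \<Longrightarrow> blk (v i) = blk (v 0)" for i
    proof (induction i)
      case (Suc i)
      then show ?case
        using adj[OF arc[of i]] by simp
    qed simp
    have "cyclic_seq (\<lambda>u w. (u, w) \<in> parcs (bipartite_graph (Inl ` {..<k}) (Inr ` {..<k})
       (\<lambda>x y. \<exists>i j. x = Inl i \<and> y = Inr j \<and> M i j))) m (g \<circ> v)"
      unfolding cyclic_seq_def
    proof (intro conjI allI impI)
      show "inj_on (g \<circ> v) {..<m}"
      proof (rule inj_onI)
        fix i j assume ij: "i \<in> {..<m}" "j \<in> {..<m}" "(g \<circ> v) i = (g \<circ> v) j"
        then have "pos (v i) = pos (v j)" and side: "v i < N \<longleftrightarrow> v j < N"
          by (auto simp: g_def split: if_splits)
        then have "idx (v i) = idx (v j)"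
          using idx_split[of "v i"] idx_split[of "v j"] blk_eq[of i] blk_eq[of j] ij(1,2) by simp
        then have "v i = v j"
          using side by (auto simp: idx_def split: if_splits)
        then show "i = j"
          using inj ij by (auto simp: inj_on_def)
      qed
    next
      fix i assume "i < m"
      then have "pos (v i) < k" "pos (v (Suc i mod m)) < k"
        using core m by auto
      then show "((g \<circ> v) i, (g \<circ> v) (Suc i mod m)) \<in> parcs (bipartite_graph (Inl ` {..<k})
          (Inr ` {..<k}) (\<lambda>x y. \<exists>i j. x = Inl i \<and> y = Inr j \<and> M i j))"
        using adj[OF arc[OF \<open>i < m\<close>]] by (auto simp: g_def bipartite_graph_def)
    qed (use m in simp)
    then show False
      using forest m by (auto simp: undirected_forest_iff)
  qed
  then have "undirected_forest U"
    using graph by (auto simp: undirected_forest_iff)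
  moreover have "transitive_set ?H ?L" "transitive_set ?H ?R"
    by (auto intro!: transitive_set_if_increasing simp: pattern_tournament_def)
  moreover have "?L \<union> ?R = pverts ?H" "?L \<inter> ?R = {}"
    by (auto simp: pattern_tournament_def)
  ultimately show ?thesis
    using tournament_pattern_tournament U unfolding tournament_forest_def by metis
qed


section \<open>Reading a pattern off an embedded tournament\<close>

definition has_pattern :: "nat \<Rightarrow> (nat \<Rightarrow> nat \<Rightarrow> bool) \<Rightarrow> nat \<Rightarrow> (nat \<Rightarrow> nat \<Rightarrow> bool) \<Rightarrow> bool" where
  "has_pattern n A k M \<longleftrightarrow>
     (\<exists>r c. strict_mono_on {..<k} r \<and> r ` {..<k} \<subseteq> {..<n} \<and>
            strict_mono_on {..<k} c \<and> c ` {..<k} \<subseteq> {..<n} \<and>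
            (\<forall>i<k. \<forall>j<k. M i j \<longrightarrow> A (r i) (c j)))"

lemma has_pattern_if_full_rectangle:
  assumes "X \<subseteq> {..<n}" "Y \<subseteq> {..<n}" "card X = k" "card Y = k" "\<And>x y. x \<in> X \<Longrightarrow> y \<in> Y \<Longrightarrow> A x y"
  shows "has_pattern n A k M"
proof -
  have fin: "finite X" "finite Y"
    using assms(1,2) by (auto intro: finite_subset)
  have "strict_mono_on {..<k} (enumerate X)" "strict_mono_on {..<k} (enumerate Y)"
    using fin assms by (auto simp: strict_mono_on_def finite_enumerate_mono)
  moreover have "enumerate X i \<in> X" "enumerate Y i \<in> Y" if "i < k" for i
    using finite_enumerate_in_set[OF fin(1)] finite_enumerate_in_set[OF fin(2)] assms(3,4) that
    by simp_all
  moreover from this have "enumerate X ` {..<k} \<subseteq> {..<n}" "enumerate Y ` {..<k} \<subseteq> {..<n}"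
    using assms(1,2) by fastforce+
  ultimately show ?thesis
    unfolding has_pattern_def using assms(5)
    by (intro exI[of _ "enumerate X"] exI[of _ "enumerate Y"] conjI) simp_all
qed

text \<open>
  Orientations of the digraph that a matrix \<open>A\<close> defines: rows are the vertices below
  \<open>n\<close>, columns are shifted by \<open>n\<close>, and a decreasing arc leads from a
  column to a row and witnesses an entry 1.
\<close>

locale ordered_host =
  fixes n :: nat and A :: "nat \<Rightarrow> nat \<Rightarrow> bool" and arc :: "nat \<Rightarrow> nat \<Rightarrow> bool"
  assumes arc_less_or_one: "arc a b \<Longrightarrow> a < b \<or> (b < n \<and> n \<le> a \<and> A b (a - n))"
begin

text \<open>
  The arc from the column \<open>\<gamma> a\<close> to the row \<open>\<rho> b\<close> decreases,
  hence is an entry 1. Only the arcs with \<open>a \<noteq> b\<close> are available, so rows and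
  columns are taken from disjoint halves of \<open>T\<close>; this gives a
  \<open>k \<times> k\<close> submatrix of ones, in which every pattern occurs.
\<close>

lemma has_pattern_if_crossing:
  assumes "finite T" "2 * k \<le> card T" "inj_on \<rho> T" "inj_on \<gamma> T"
    and "\<And>a. a \<in> T \<Longrightarrow> \<rho> a < n" "\<And>a. a \<in> T \<Longrightarrow> n \<le> \<gamma> a \<and> \<gamma> a < 2 * n"
    and "\<And>a b. a \<in> T \<Longrightarrow> b \<in> T \<Longrightarrow> a \<noteq> b \<Longrightarrow> arc (\<gamma> a) (\<rho> b)"
  shows "has_pattern n A k M"
proof -
  obtain T1 where T1: "T1 \<subseteq> T" "card T1 = k"
    using obtain_subset_with_card_n[of k T] assms(2) by auto
  then have "k \<le> card (T - T1)"
    using assms(1,2) by (simp add: card_Diff_subset finite_subset)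
  then obtain T2 where T2: "T2 \<subseteq> T - T1" "card T2 = k"
    using obtain_subset_with_card_n by metis
  show ?thesis
  proof (rule has_pattern_if_full_rectangle[of "\<rho> ` T1" n "(\<lambda>a. \<gamma> a - n) ` T2"])
    show "card (\<rho> ` T1) = k"
      using T1 assms(3) by (metis card_image inj_on_subset)
    have "inj_on (\<lambda>a. \<gamma> a - n) T"
      using assms(4,6) by (auto simp: inj_on_def) (metis eq_diff_iff)
    then show "card ((\<lambda>a. \<gamma> a - n) ` T2) = k"
      using T2 by (metis Diff_subset card_image inj_on_subset order_trans)
    show "\<rho> ` T1 \<subseteq> {..<n}" "(\<lambda>a. \<gamma> a - n) ` T2 \<subseteq> {..<n}"
      using T1 T2 assms(5,6) by fastforce+
  next
    fix x y assume "x \<in> \<rho> ` T1" "y \<in> (\<lambda>a. \<gamma> a - n) ` T2"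
    then obtain a b where ab: "a \<in> T2" "b \<in> T1" "x = \<rho> b" "y = \<gamma> a - n"
      by auto
    then have "a \<in> T" "b \<in> T" "a \<noteq> b"
      using T1 T2 by auto
    then show "A x y"
      using arc_less_or_one[of "\<gamma> a" "\<rho> b"] assms(5)[of b] assms(6)[of a] assms(7)[of a b] ab by simp
  qed
qed

text \<open>Rows alone, and columns alone, are ordered transitively.\<close>

lemma cyclic_triangle_mixed:
  assumes "arc a b" "arc b c" "arc c a"
  shows "\<exists>x\<in>{a, b, c}. n \<le> x" "\<exists>x\<in>{a, b, c}. x < n"
  using assms[THEN arc_less_or_one] by auto

text \<open>
  An embedding need not send rows to rows and columns to columns, and the two cases below deal
  with that. If some block is embedded correctly, its copy of \<open>M\<close> appears in
  \<open>A\<close> with the right order of rows and columns, since among rows, and among columns,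
  arcs of both tournaments increase. Otherwise each of the \<open>4 * k + 1\<close> blocks has a
  row sent to a column or a column sent to a row, and \<open>2 * k + 1\<close> blocks have a fault
  of the same kind.

  Say they have rows \<open>l a\<close> sent to columns. If \<open>a < b\<close>, then
  \<open>l a\<close>, \<open>l b\<close> and the private neighbour of \<open>l a\<close> form a
  cyclic triangle, so this neighbour, a column, is sent to a row. Across different blocks rows
  precede columns, so the arcs from the misplaced \<open>l a\<close> to the misplaced private
  neighbours of the other \<open>l b\<close> lead from columns to rows, and \<open>A\<close> has a
  large submatrix of ones. Misplaced columns are symmetric, with \<open>a > b\<close>. The last
  block (or the first one, for columns) lacks a partner for the triangle, hence
  \<open>2 * k + 1\<close> blocks instead of \<open>2 * k\<close>.
\<close>

lemma has_pattern_if_embeds: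
  fixes f :: "nat \<Rightarrow> nat" and k :: nat
  defines "N \<equiv> (4 * k + 1) * (2 * k)"
  assumes inj: "inj_on f {..<2 * N}" and range: "\<And>u. u < 2 * N \<Longrightarrow> f u < 2 * n"
    and embed: "\<And>u v. (u, v) \<in> parcs (pattern_tournament N (block_copies k M)) \<Longrightarrow> arc (f u) (f v)"
  shows "has_pattern n A k M"
proof -
  let ?H = "pattern_tournament N (block_copies k M)"
  define row where "row a x = a * (2 * k) + x" for a x
  define col where "col a x = N + row a x" for a x
  have row_less: "row a x < N" if "a < 4 * k + 1" "x < 2 * k" for a x
  proof -
    have "row a x < (a + 1) * (2 * k)"
      using that by (simp add: row_def)
    also have "\<dots> \<le> N"
      unfolding N_def using that by (intro mult_right_mono) auto
    finally show ?thesis .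
  qed
  have blk[simp]: "row a x div (2 * k) = a" "row a x mod (2 * k) = x" if "x < 2 * k" for a x
    using that by (auto simp: row_def)
  have row_mono: "row a x < row b y" if "a < b" "x < 2 * k" for a b x y
  proof -
    have "row a x < (a + 1) * (2 * k)"
      using that by (simp add: row_def)
    also have "\<dots> \<le> b * (2 * k)"
      using that by (intro mult_right_mono) auto
    finally show ?thesis
      by (simp add: row_def)
  qed
  have row_row: "arc (f (row a x)) (f (row b y))"
    if "a < b \<or> (a = b \<and> x < y)" "a < 4 * k + 1" "b < 4 * k + 1" "x < 2 * k" "y < 2 * k" for a b x y
    using that row_less[of a x] row_less[of b y] row_mono[of a b x y]
    by (intro embed) (auto simp: pattern_tournament_def row_def)
  have col_col: "arc (f (col a x)) (f (col b y))"
    if "a < b \<or> (a = b \<and> x < y)" "a < 4 * k + 1" "b < 4 * k + 1" "x < 2 * k" "y < 2 * k" for a b x y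
    using that row_less[of a x] row_less[of b y] row_mono[of a b x y]
    by (intro embed) (auto simp: pattern_tournament_def col_def row_def)
  have col_row: "arc (f (col a y)) (f (row a x))"
    if "with_pendants k M x y" "a < 4 * k + 1" "x < 2 * k" "y < 2 * k" for a x y
    using that row_less[of a x] row_less[of a y]
    by (intro embed) (auto simp: pattern_tournament_def col_def block_copies_def)
  have row_col: "arc (f (row a x)) (f (col b y))"
    if "a \<noteq> b" "a < 4 * k + 1" "b < 4 * k + 1" "x < 2 * k" "y < 2 * k" for a b x y
    using that row_less[of a x] row_less[of b y]
    by (intro embed) (auto simp: pattern_tournament_def col_def block_copies_def)
  have vertex: "row a x < 2 * N" "col a x < 2 * N" if "a < 4 * k + 1" "x < 2 * k" for a x
    using row_less[OF that] by (auto simp: col_def)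
  have block_eq: "a = b" if "f (row a x) = f (row b y) \<or> f (col a x) = f (col b y)"
    "a < 4 * k + 1" "b < 4 * k + 1" "x < 2 * k" "y < 2 * k" for a b x y
  proof -
    have "row a x = row b y"
      using that vertex inj_onD[OF inj, of "row a x" "row b y"] inj_onD[OF inj, of "col a x" "col b y"]
      by (auto simp: col_def)
    then show ?thesis
      using blk(1) that(4,5) by metis
  qed
  \<comment> \<open>The blocks with a misplaced row, and those with a misplaced column.\<close>
  define T1 where "T1 = {a. a < 4 * k + 1 \<and> (\<exists>x<k. n \<le> f (row a x))}"
  define T2 where "T2 = {a. a < 4 * k + 1 \<and> (\<exists>y<k. f (col a y) < n)}"
  have fin: "finite T1" "finite T2"
    by (auto simp: T1_def T2_def)
  show ?thesis
  proof (cases "T1 \<union> T2 = {..<4 * k + 1}")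
    case False
    moreover have "T1 \<union> T2 \<subseteq> {..<4 * k + 1}"
      by (auto simp: T1_def T2_def)
    ultimately obtain a where a: "a < 4 * k + 1" and "a \<notin> T1" "a \<notin> T2"
      by blast
    have rows: "f (row a x) < n" if "x < k" for x
    proof -
      have "\<not> n \<le> f (row a x)"
        using a \<open>a \<notin> T1\<close> that unfolding T1_def by blast
      then show ?thesis
        by simp
    qed
    have cols: "n \<le> f (col a y)" if "y < k" for y
    proof -
      have "\<not> f (col a y) < n"
        using a \<open>a \<notin> T2\<close> that unfolding T2_def by blast
      then show ?thesis
        by simp
    qed
    have "strict_mono_on {..<k} (\<lambda>x. f (row a x))"
    proof (rule strict_mono_onI)
      fix x y assume "x \<in> {..<k}" "y \<in> {..<k}" "x < y"
      then show "f (row a x) < f (row a y)"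
        using arc_less_or_one[OF row_row[of a a x y]] rows[of x] a by simp
    qed
    moreover have "strict_mono_on {..<k} (\<lambda>y. f (col a y) - n)"
    proof (rule strict_mono_onI)
      fix x y assume "x \<in> {..<k}" "y \<in> {..<k}" "x < y"
      then show "f (col a x) - n < f (col a y) - n"
        using arc_less_or_one[OF col_col[of a a x y]] cols[of x] cols[of y] a by simp
    qed
    moreover have "A (f (row a x)) (f (col a y) - n)" if "x < k" "y < k" "M x y" for x y
      using arc_less_or_one[OF col_row[of x y a]] rows[of x] cols[of y] a that
      by (simp add: with_pendants_def)
    moreover have "f (col a y) - n < n" if "y < k" for y
      using range[of "col a y"] vertex(2)[of a y] cols[of y] a that by simp
    ultimately show ?thesis
      unfolding has_pattern_def using rows
      by (intro exI[of _ "\<lambda>x. f (row a x)"] exI[of _ "\<lambda>y. f (col a y) - n"]) auto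
  next
    case True
    have "card (T1 \<union> T2) \<le> card T1 + card T2"
      by (rule card_Un_le)
    then have "2 * k + 1 \<le> card T1 \<or> 2 * k + 1 \<le> card T2"
      unfolding True by simp linarith
    then show ?thesis
    proof
      assume card: "2 * k + 1 \<le> card T1"
      obtain \<xi> where \<xi>: "\<And>a. a \<in> T1 \<Longrightarrow> \<xi> a < k \<and> n \<le> f (row a (\<xi> a))"
        unfolding T1_def by atomize_elim (rule choice, auto)
      have T1_less: "a \<in> T1 \<Longrightarrow> a < 4 * k + 1" for a
        by (simp add: T1_def)
      define T where "T = T1 - {Max T1}"
      have T_sub: "a \<in> T \<Longrightarrow> a \<in> T1" for a
        by (simp add: T_def)
      have crossed: "f (col a (\<xi> a + k)) < n" if "a \<in> T" for a
      proof -
        let ?b = "Max T1"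
        have nonempty: "T1 \<noteq> {}"
          using T_sub[OF that] by auto
        have b: "?b \<in> T1" "a < ?b"
          using that fin Max_in[of T1, OF _ nonempty] Max_ge[of T1 a] by (auto simp: T_def le_neq_implies_less)
        note a = T_sub[OF that]
        have "arc (f (row a (\<xi> a))) (f (row ?b (\<xi> ?b)))"
          using \<xi>[OF a] \<xi>[OF b(1)] T1_less[OF a] T1_less[OF b(1)] b by (intro row_row) auto
        moreover have "arc (f (row ?b (\<xi> ?b))) (f (col a (\<xi> a + k)))"
          using \<xi>[OF a] \<xi>[OF b(1)] T1_less[OF a] T1_less[OF b(1)] b by (intro row_col) auto
        moreover have "arc (f (col a (\<xi> a + k))) (f (row a (\<xi> a)))"
          using \<xi>[OF a] T1_less[OF a] by (intro col_row) (auto simp: with_pendants_def)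
        ultimately show ?thesis
          using cyclic_triangle_mixed(2) \<xi>[OF a] \<xi>[OF b(1)] by fastforce
      qed
      show ?thesis
      proof (rule has_pattern_if_crossing[of T])
        show "finite T" "2 * k \<le> card T"
          using fin card by (auto simp: T_def card_Diff_singleton_if)
        show "inj_on (\<lambda>a. f (col a (\<xi> a + k))) T"
        proof (rule inj_onI)
          fix a b assume ab: "a \<in> T" "b \<in> T" "f (col a (\<xi> a + k)) = f (col b (\<xi> b + k))"
          note T = T_sub[OF ab(1)] T_sub[OF ab(2)]
          show "a = b"
            using ab(3) \<xi>[OF T(1)] \<xi>[OF T(2)] T1_less[OF T(1)] T1_less[OF T(2)]
            by (intro block_eq[of a "\<xi> a + k" b "\<xi> b + k"]) auto
        qed
        show "inj_on (\<lambda>a. f (row a (\<xi> a))) T"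
        proof (rule inj_onI)
          fix a b assume ab: "a \<in> T" "b \<in> T" "f (row a (\<xi> a)) = f (row b (\<xi> b))"
          note T = T_sub[OF ab(1)] T_sub[OF ab(2)]
          show "a = b"
            using ab(3) \<xi>[OF T(1)] \<xi>[OF T(2)] T1_less[OF T(1)] T1_less[OF T(2)]
            by (intro block_eq[of a "\<xi> a" b "\<xi> b"]) auto
        qed
        show "n \<le> f (row a (\<xi> a)) \<and> f (row a (\<xi> a)) < 2 * n" if "a \<in> T" for a
          using \<xi>[OF T_sub[OF that]] T1_less[OF T_sub[OF that]] by (auto intro!: range vertex)
        show "arc (f (row a (\<xi> a))) (f (col b (\<xi> b + k)))" if "a \<in> T" "b \<in> T" "a \<noteq> b" for a b
          using \<xi>[OF T_sub[OF that(1)]] \<xi>[OF T_sub[OF that(2)]]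
            T1_less[OF T_sub[OF that(1)]] T1_less[OF T_sub[OF that(2)]] that(3)
          by (intro row_col) auto
      qed (use crossed in auto)
    next
      assume card: "2 * k + 1 \<le> card T2"
      obtain \<xi> where \<xi>: "\<And>a. a \<in> T2 \<Longrightarrow> \<xi> a < k \<and> f (col a (\<xi> a)) < n"
        unfolding T2_def by atomize_elim (rule choice, auto)
      have T2_less: "a \<in> T2 \<Longrightarrow> a < 4 * k + 1" for a
        by (simp add: T2_def)
      define T where "T = T2 - {Min T2}"
      have T_sub: "a \<in> T \<Longrightarrow> a \<in> T2" for a
        by (simp add: T_def)
      have crossed: "n \<le> f (row a (\<xi> a + k))" if "a \<in> T" for a
      proof -
        let ?b = "Min T2"
        have nonempty: "T2 \<noteq> {}"
          using T_sub[OF that] by auto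
        have b: "?b \<in> T2" "?b < a"
          using that fin Min_in[of T2, OF _ nonempty] Min_le[of T2 a] by (auto simp: T_def le_neq_implies_less)
        note a = T_sub[OF that]
        have "arc (f (col ?b (\<xi> ?b))) (f (col a (\<xi> a)))"
          using \<xi>[OF a] \<xi>[OF b(1)] T2_less[OF a] T2_less[OF b(1)] b by (intro col_col) auto
        moreover have "arc (f (col a (\<xi> a))) (f (row a (\<xi> a + k)))"
          using \<xi>[OF a] T2_less[OF a] by (intro col_row) (auto simp: with_pendants_def)
        moreover have "arc (f (row a (\<xi> a + k))) (f (col ?b (\<xi> ?b)))"
          using \<xi>[OF a] \<xi>[OF b(1)] T2_less[OF a] T2_less[OF b(1)] b by (intro row_col) auto
        ultimately show ?thesis
          using cyclic_triangle_mixed(1) \<xi>[OF a] \<xi>[OF b(1)] by fastforce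
      qed
      show ?thesis
      proof (rule has_pattern_if_crossing[of T])
        show "finite T" "2 * k \<le> card T"
          using fin card by (auto simp: T_def card_Diff_singleton_if)
        show "inj_on (\<lambda>a. f (col a (\<xi> a))) T"
        proof (rule inj_onI)
          fix a b assume ab: "a \<in> T" "b \<in> T" "f (col a (\<xi> a)) = f (col b (\<xi> b))"
          note T = T_sub[OF ab(1)] T_sub[OF ab(2)]
          show "a = b"
            using ab(3) \<xi>[OF T(1)] \<xi>[OF T(2)] T2_less[OF T(1)] T2_less[OF T(2)]
            by (intro block_eq[of a "\<xi> a" b "\<xi> b"]) auto
        qed
        show "inj_on (\<lambda>a. f (row a (\<xi> a + k))) T"
        proof (rule inj_onI)
          fix a b assume ab: "a \<in> T" "b \<in> T" "f (row a (\<xi> a + k)) = f (row b (\<xi> b + k))"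
          note T = T_sub[OF ab(1)] T_sub[OF ab(2)]
          show "a = b"
            using ab(3) \<xi>[OF T(1)] \<xi>[OF T(2)] T2_less[OF T(1)] T2_less[OF T(2)]
            by (intro block_eq[of a "\<xi> a + k" b "\<xi> b + k"]) auto
        qed
        show "n \<le> f (row a (\<xi> a + k)) \<and> f (row a (\<xi> a + k)) < 2 * n" if "a \<in> T" for a
          using crossed[OF that] \<xi>[OF T_sub[OF that]] T2_less[OF T_sub[OF that]]
          by (auto intro!: range vertex)
        show "arc (f (row a (\<xi> a + k))) (f (col b (\<xi> b)))" if "a \<in> T" "b \<in> T" "a \<noteq> b" for a b
          using \<xi>[OF T_sub[OF that(1)]] \<xi>[OF T_sub[OF that(2)]]
            T2_less[OF T_sub[OF that(1)]] T2_less[OF T_sub[OF that(2)]] that(3)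
          by (intro row_col) auto
      qed (use T_sub \<xi> in auto)
    qed
  qed
qed

end


section \<open>Subgraphs isomorphic to a given tournament\<close>

lemma embedding_if_not_free:
  fixes H :: "'b pair_pre_digraph" and G :: "'a pair_pre_digraph"
  assumes "\<not> free_of H G"
  obtains f where "inj_on f (pverts H)" "f ` pverts H \<subseteq> pverts G"
    "\<And>u v. (u, v) \<in> parcs H \<Longrightarrow> (f u, f v) \<in> parcs G"
proof -
  obtain K :: "'a pair_pre_digraph" and h where K: "subgraph (with_proj K) (with_proj G)"
      and h: "pre_digraph.digraph_isomorphism (with_proj K) h" "with_proj H = app_iso h (with_proj K)"
    using assms unfolding free_of_def digraph_iso_def by auto
  have H: "pverts H = iso_verts h ` pverts K" "parcs H = iso_arcs h ` parcs K"
      "iso_tail h = fst" "iso_head h = snd"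
    using h(2) by (auto simp: with_proj_def app_iso_def)
  have iso: "wf_digraph (with_proj K)" "inj_on (iso_verts h) (pverts K)"
      "\<And>a. a \<in> parcs K \<Longrightarrow> iso_verts h (fst a) = fst (iso_arcs h a) \<and> iso_verts h (snd a) = snd (iso_arcs h a)"
    using h(1) H(3,4) by (auto simp: pre_digraph.digraph_isomorphism_def)
  define f where "f = the_inv_into (pverts K) (iso_verts h)"
  have f: "f (iso_verts h x) = x" if "x \<in> pverts K" for x
    unfolding f_def using iso(2) that by (rule the_inv_into_f_f)
  show ?thesis
  proof (rule that[of f])
    show "inj_on f (pverts H)"
      by (auto simp: H inj_on_def f)
    show "f ` pverts H \<subseteq> pverts G"
      using K by (auto simp: H f subgraph_def)
    show "(f u, f v) \<in> parcs G" if "(u, v) \<in> parcs H" for u v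
    proof -
      have "(u, v) \<in> iso_arcs h ` parcs K"
        using that by (simp only: H(2))
      then obtain a where a: "iso_arcs h a = (u, v)" "a \<in> parcs K"
        by (elim imageE) (rule that, rule sym)
      then have "fst a \<in> pverts K" "snd a \<in> pverts K"
        using wf_digraph.tail_in_verts[OF iso(1), of a] wf_digraph.head_in_verts[OF iso(1), of a]
        by simp_all
      then have "f u = fst a" "f v = snd a"
        using iso(3)[OF a(2)] a(1) f by force+
      then show ?thesis
        using a(2) K by (auto simp: subgraph_def)
    qed
  qed
qed


section \<open>Matrices as semi-complete digraphs\<close>

text \<open>Columns are shifted by \<open>n\<close>, so that they come after all rows.\<close>

definition one_edges :: "nat \<Rightarrow> (nat \<Rightarrow> nat \<Rightarrow> bool) \<Rightarrow> (nat \<times> nat) set" where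
  "one_edges n A = (let D = {(i, n + j) | i j. i < n \<and> j < n \<and> A i j} in D \<union> D\<inverse>)"

text \<open>
  The rows and columns in \<open>W\<close>, ordered transitively with rows before columns; exactly
  the entries 1 give bidirectional pairs, so a decreasing arc in an orientation is an entry 1.
\<close>

definition matrix_digraph :: "nat \<Rightarrow> (nat \<Rightarrow> nat \<Rightarrow> bool) \<Rightarrow> nat set \<Rightarrow> nat pair_pre_digraph" where
  "matrix_digraph n A W =
     \<lparr>pverts = W, parcs = {(u, v) \<in> W \<times> W. u < v \<or> (u, v) \<in> one_edges n A}\<rparr>"

lemma sym_one_edges: "sym (one_edges n A)"
  by (auto simp: one_edges_def sym_def Let_def)

lemma irrefl_one_edges: "irrefl (one_edges n A)"
  by (auto simp: one_edges_def irrefl_def Let_def)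

lemma card_one_edges: "card (one_edges n A) = 2 * card {(i, j). i < n \<and> j < n \<and> A i j}"
proof -
  let ?O = "{(i, j). i < n \<and> j < n \<and> A i j}"
  let ?D = "{(i, n + j) | i j. i < n \<and> j < n \<and> A i j}"
  have "?O \<subseteq> {..<n} \<times> {..<n}"
    by auto
  then have "finite ?O"
    by (rule finite_subset) auto
  have D: "?D = (\<lambda>(i, j). (i, n + j)) ` ?O"
    by auto
  have "inj_on (\<lambda>(i, j). (i, n + j)) ?O"
    by (auto simp: inj_on_def)
  then have "card ?D = card ?O"
    unfolding D by (rule card_image)
  moreover have "finite ?D"
    unfolding D using \<open>finite ?O\<close> by (rule finite_imageI)
  moreover have "?D \<inter> ?D\<inverse> = {}"
    by auto
  ultimately show ?thesis
    by (simp add: one_edges_def Let_def card_Un_disjoint)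
qed

lemma bidirectional_matrix_digraph:
  "bidirectional_graph (matrix_digraph n A W) = \<lparr>pverts = W, parcs = one_edges n A \<inter> W \<times> W\<rparr>"
  using symD[OF sym_one_edges[of n A]]
  by (auto simp: bidirectional_graph_def matrix_digraph_def)

lemma semi_complete_matrix_digraph:
  assumes "finite W"
  shows "semi_complete (matrix_digraph n A W)"
proof -
  have "parcs (matrix_digraph n A W) \<subseteq> W \<times> W"
    by (auto simp: matrix_digraph_def)
  then have "finite (parcs (matrix_digraph n A W))"
    using assms by (meson finite_SigmaI finite_subset)
  then have "pair_digraph (matrix_digraph n A W)"
    using assms irrefl_one_edges[of n A] by unfold_locales (auto simp: matrix_digraph_def irrefl_def)
  then show ?thesis
    by (auto simp: semi_complete_def matrix_digraph_def)
qed

text \<open>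
  Lying in \<open>Q\<close> and not being prime together have probability less than 1. A prime
  tournament outside \<open>Q\<close> contains \<open>H\<close>, because \<open>Q\<close> is
  \<open>H\<close>-useful.
\<close>

lemma exists_orientation_containing:
  fixes H :: "'b pair_pre_digraph" and F :: "'a pair_pre_digraph"
  assumes "useful H Q" "measure_pmf.prob (random_tournament F) Q < 1 / 2"
    and F: "semi_complete_expander d F" "8 * log 2 (real (card (pverts F))) \<le> d"
  shows "\<exists>G. \<not> free_of H G \<and> pverts G = pverts F \<and> parcs G \<subseteq> parcs F"
proof -
  let ?P = "measure_pmf.prob (random_tournament F)"
  have dig: "pair_digraph F"
    using F(1) by (simp add: semi_complete_expander_def semi_complete_def)
  have "?P (Q \<union> {G. \<not> prime_tournament G}) \<le> ?P Q + ?P {G. \<not> prime_tournament G}"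
    by (rule measure_Un_le) auto
  also have "\<dots> < 1"
    using assms(2) prob_not_prime_le[OF F] by linarith
  finally have "\<not> set_pmf (random_tournament F) \<subseteq> Q \<union> {G. \<not> prime_tournament G}"
    using measure_pmf.prob_eq_1[of "Q \<union> {G. \<not> prime_tournament G}" "random_tournament F"]
    by (auto simp: AE_measure_pmf_iff)
  then obtain G where G: "G \<in> set_pmf (random_tournament F)" "G \<notin> Q" "prime_tournament G"
    by auto
  then obtain c where "c \<in> choices F" "G = resolve F c"
    using choices_finite_card[OF dig] by (auto simp: random_tournament_eq[OF dig])
  then have "pverts G = pverts F" "parcs G \<subseteq> parcs F"
    using arc_resolve_iff[of c F] by auto
  moreover have "\<not> free_of H G"
    using assms(1) G by (auto simp: useful_def)
  ultimately show ?thesis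
    by blast
qed

text \<open>
  The graph of the ones has at most \<open>2 * n\<close> vertices, so an expansion of
  \<open>\<beta> * log 2 (2 * n) powr \<beta>\<close> is enough for the subgraph \<open>W\<close>
  whatever its size. Taking \<open>\<beta>\<close> at least \<open>b\<close> serves the sparseness
  of \<open>Q\<close>, and at least 8 the primality of random orientations.
\<close>

lemma has_pattern_if_many_ones:
  fixes A M :: "nat \<Rightarrow> nat \<Rightarrow> bool" and n k :: nat and b :: real
    and Q :: "nat pair_pre_digraph set"
  defines "H \<equiv> pattern_tournament ((4 * k + 1) * (2 * k)) (block_copies k M)"
    and "\<beta> \<equiv> max b 8"
  assumes "useful H Q" "0 < b"
    and sparse: "\<And>F. semi_complete_expander (b * log 2 (real (card (pverts F))) powr b) F \<Longrightarrow>
      measure_pmf.prob (random_tournament F) Q < 1 / 2"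
    and "0 < n"
    and many: "2 * \<beta> * real n * log 2 (real (2 * n)) powr (\<beta> + 1) < real (card {(i, j). i < n \<and> j < n \<and> A i j})"
  shows "has_pattern n A k M"
proof -
  let ?E = "one_edges n A" and ?V = "{..<2 * n}"
  define l where "l = log 2 (real (2 * n))"
  define d where "d = \<beta> * l powr \<beta>"
  have l: "1 \<le> l" and \<beta>: "b \<le> \<beta>" "8 \<le> \<beta>"
    using \<open>0 < n\<close> by (auto simp: l_def \<beta>_def)
  then have "0 \<le> d"
    by (simp add: d_def)
  have log_V: "log 2 (real (card ?V)) = l"
    by (simp add: l_def)
  have l_powr: "l powr (\<beta> + 1) = l powr \<beta> * l"
    using l by (simp add: powr_add)
  have "2 * d * real (card ?V) * log 2 (real (card ?V)) = 2 * (2 * \<beta> * real n * l powr (\<beta> + 1))"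
    unfolding log_V l_powr by (simp add: d_def)
  also have "\<dots> < real (card ?E)"
    using many by (simp add: card_one_edges l_def)
  also have "?E = ?E \<inter> ?V \<times> ?V"
    by (auto simp: one_edges_def Let_def)
  finally have large: "2 * d * real (card ?V) * log 2 (real (card ?V)) < real (card (?E \<inter> ?V \<times> ?V))" .
  have "\<exists>W\<subseteq>?V. expander d \<lparr>pverts = W, parcs = ?E \<inter> W \<times> W\<rparr>"
  proof (rule ccontr)
    assume W: "\<not> ?thesis"
    then have "\<not> expander d \<lparr>pverts = W, parcs = ?E \<inter> W \<times> W\<rparr>" if "W \<subseteq> ?V" for W
      using W that by blast
    moreover have "?V \<noteq> {}"
      using \<open>0 < n\<close> by (simp add: lessThan_empty_iff)
    ultimately have "real (card (?E \<inter> ?V \<times> ?V)) \<le> 2 * d * real (card ?V) * log 2 (real (card ?V))"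
      by (intro card_edges_le_if_no_expander sym_one_edges irrefl_one_edges \<open>0 \<le> d\<close> finite_lessThan)
    with large show False
      by linarith
  qed
  then obtain W where W: "W \<subseteq> ?V" "expander d \<lparr>pverts = W, parcs = ?E \<inter> W \<times> W\<rparr>"
    by blast
  define F where "F = matrix_digraph n A W"
  have fin: "finite W"
    using W(1) finite_subset by blast
  have verts: "pverts F = W"
    by (simp add: F_def matrix_digraph_def)
  have F: "semi_complete_expander d F"
    using W(2) semi_complete_matrix_digraph[OF fin]
    by (simp add: semi_complete_expander_def F_def bidirectional_matrix_digraph)
  have "2 \<le> card W" "card W \<le> 2 * n"
    using W card_mono[OF _ W(1)] by (auto simp: expander_def)
  then have logW: "1 \<le> log 2 (real (card W))" "log 2 (real (card W)) \<le> l"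
    using \<open>0 < n\<close> by (auto simp: l_def simp flip: of_nat_mult)
  have "log 2 (real (card W)) powr b \<le> l powr b"
    using logW \<open>0 < b\<close> by (intro powr_mono2) auto
  also have "\<dots> \<le> l powr \<beta>"
    using l \<beta> by (intro powr_mono) auto
  finally have d1: "b * log 2 (real (card W)) powr b \<le> d"
    unfolding d_def using \<beta> \<open>0 < b\<close> by (intro mult_mono) auto
  have "l powr 1 \<le> l powr \<beta>"
    using l \<beta> by (intro powr_mono) auto
  then have d2: "8 * log 2 (real (card W)) \<le> d"
    unfolding d_def using \<beta> l logW by (intro mult_mono) auto
  have F_b: "semi_complete_expander (b * log 2 (real (card (pverts F))) powr b) F"
    using F d1 expander_antimono unfolding semi_complete_expander_def verts by blast
  then obtain G where G: "\<not> free_of H G" "pverts G = W" "parcs G \<subseteq> parcs F"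
    using exists_orientation_containing[OF \<open>useful H Q\<close> sparse[OF F_b] F] d2 verts by auto
  obtain f where f: "inj_on f (pverts H)" "f ` pverts H \<subseteq> pverts G"
      "\<And>u v. (u, v) \<in> parcs H \<Longrightarrow> (f u, f v) \<in> parcs G"
    using embedding_if_not_free[OF G(1)] by blast
  interpret ordered_host n A "\<lambda>u v. (u, v) \<in> parcs G"
  proof
    fix u v assume "(u, v) \<in> parcs G"
    then have "u < v \<or> (u, v) \<in> ?E"
      using G(3) by (auto simp: F_def matrix_digraph_def)
    then show "u < v \<or> (v < n \<and> n \<le> u \<and> A v (u - n))"
      by (auto simp: one_edges_def Let_def)
  qed
  have "pverts H = {..<2 * ((4 * k + 1) * (2 * k))}"
    by (simp add: H_def pattern_tournament_def)
  then show ?thesis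
    using f G(2) W(1) unfolding H_def by (intro has_pattern_if_embeds[of f k M]) auto
qed

theorem corollary1:
  fixes M :: "nat mat" and k :: nat
  assumes "\<forall>H :: nat pair_pre_digraph. tournament_forest H \<longrightarrow>
             (\<exists>Q :: nat pair_pre_digraph set. Q \<subseteq> {G. tournament G} \<and> sparse_family Q \<and> useful H Q)"
    and "zero_one_mat k M"
    and "forest_mat M"
  shows "\<exists>C>0. \<exists>p>0. \<forall>\<^sub>F n in sequentially.
           real (ex_mat n M) \<le> C * real n * log 2 (real n) powr p"
proof -
  define M' where "M' i j \<longleftrightarrow> M $$ (i, j) = 1" for i j
  define H where "H = pattern_tournament ((4 * k + 1) * (2 * k)) (block_copies k M')"
  have dim: "dim_row M = k" "dim_col M = k"
    using assms(2) by (auto simp: zero_one_mat_def)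
  have "tournament_forest H"
    unfolding H_def using assms(3)
    by (intro tournament_forest_block_copies) (simp add: forest_mat_def dim M'_def)
  then obtain Q :: "nat pair_pre_digraph set" where "sparse_family Q" and Q: "useful H Q"
    using assms(1) by blast
  then obtain b where b: "0 < b" and sparse: "\<And>F :: nat pair_pre_digraph.
      semi_complete_expander (b * log 2 (real (card (pverts F))) powr b) F \<Longrightarrow>
      measure_pmf.prob (random_tournament F) Q < 1 / 2"
    unfolding sparse_family_def by blast
  define \<beta> where "\<beta> = max b 8"
  define C where "C = 2 * \<beta> * 2 powr (\<beta> + 1) + 1"
  have \<beta>: "8 \<le> \<beta>"
    by (simp add: \<beta>_def)
  have "real (ex_mat n M) \<le> C * real n * log 2 (real n) powr (\<beta> + 1)" if n: "2 \<le> n" for n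
  proof -
    define T where "T = 2 * \<beta> * real n * log 2 (real (2 * n)) powr (\<beta> + 1)"
    define m where "m = nat \<lfloor>T\<rfloor> + 1"
    have T: "0 \<le> T"
      using \<beta> by (simp add: T_def)
    have m: "T < real m" "real m \<le> T + 1"
      using T unfolding m_def by linarith+
    have "contains_pattern A M" if A: "zero_one_mat n A" "m \<le> num_ones A" for A
    proof -
      define A' where "A' i j \<longleftrightarrow> A $$ (i, j) = 1" for i j
      have dim_A: "dim_row A = n" "dim_col A = n"
        using A(1) by (auto simp: zero_one_mat_def)
      have "T < real (card {(i, j). i < n \<and> j < n \<and> A' i j})"
        using A(2) m(1) by (simp add: num_ones_def dim_A A'_def)
      then have "has_pattern n A' k M'"
        using n unfolding T_def \<beta>_def
        by (intro has_pattern_if_many_ones[OF Q[unfolded H_def] b sparse]) auto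
      then show ?thesis
        by (simp add: has_pattern_def contains_pattern_def dim dim_A A'_def M'_def)
    qed
    then have "ex_mat n M \<le> m"
      unfolding ex_mat_def by (intro Least_le) blast
    then have "real (ex_mat n M) \<le> T + 1"
      using m(2) by linarith
    have log_n: "1 \<le> log 2 (real n)"
      using n by simp
    then have "log 2 (real (2 * n)) \<le> 2 * log 2 (real n)"
      using n by (simp add: log_mult)
    moreover have "0 \<le> log 2 (real (2 * n))"
      using n by simp
    ultimately have "log 2 (real (2 * n)) powr (\<beta> + 1) \<le> (2 * log 2 (real n)) powr (\<beta> + 1)"
      using \<beta> by (intro powr_mono2) auto
    also have "\<dots> = 2 powr (\<beta> + 1) * log 2 (real n) powr (\<beta> + 1)"
      by (rule powr_mult)
    finally have "T \<le> 2 * \<beta> * real n * (2 powr (\<beta> + 1) * log 2 (real n) powr (\<beta> + 1))"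
      unfolding T_def using \<beta> by (intro mult_left_mono) auto
    moreover have "1 \<le> real n * log 2 (real n) powr (\<beta> + 1)"
    proof -
      have "1 * 1 \<le> real n * log 2 (real n) powr (\<beta> + 1)"
        using n log_n \<beta> by (intro mult_mono ge_one_powr_ge_zero) auto
      then show ?thesis
        by simp
    qed
    ultimately have "T + 1 \<le> C * real n * log 2 (real n) powr (\<beta> + 1)"
      by (simp add: C_def algebra_simps)
    then show ?thesis
      using \<open>real (ex_mat n M) \<le> T + 1\<close> by linarith
  qed
  then have "\<forall>\<^sub>F n in sequentially. real (ex_mat n M) \<le> C * real n * log 2 (real n) powr (\<beta> + 1)"
    by (auto simp: eventually_sequentially)
  moreover have "0 < C" "0 < \<beta> + 1"
    using \<beta> by (auto simp: C_def intro!: add_nonneg_pos)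
  ultimately show ?thesis
    by blast
qed

end
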